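(* Let $p$ be a prime and let $G$ be an insoluble just-infinite pro-$p$ group. Then $\mathcal{S}(G)$ is homeomorphic to Pełczyński space $P$.
   Context: For a profinite group $G$, $\mathcal{S}(G)$ is the set of closed subgroups of $G$ with its natural profinite topology: a base of open neighbourhoods of $H\in\mathcal{S}(G)$ is given by the sets $B(H,N)=\{K \text{ closed subgroup of } G \mid KN=HN\}$, with $N$ ranging over the open normal subgroups of $G$. A profinite group is just-infinite if it is infinite and every non-trivial closed normal subgroup is open. Pełczyński space $P$ is the subspace of $[0,1]$ consisting of the middle-third Cantor set together with the midpoints of all the open intervals deleted in its construction. *)

theory Defs
  imports
    "HOL-Analysis.Analysis"
    "HOL-Algebra.Solvable_Groups"
    "HOL-Computational_Algebra.Primes"
begin

section \<open>Profinite groups\<close>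

locale topological_group = group G for G :: "('a, 'b) monoid_scheme" (structure) +
  fixes T :: "'a topology"
  assumes topspace_eq_carrier: "topspace T = carrier G"
    and continuous_mult: "continuous_map (prod_topology T T) T (\<lambda>(x, y). x \<otimes> y)"
    and continuous_inv: "continuous_map T T (\<lambda>x. inv x)"

locale profinite_group = topological_group +
  assumes compact: "compact_space T"
    and Hausdorff: "Hausdorff_space T"
    and totally_disconnected: "\<And>S. connectedin T S \<Longrightarrow> \<exists>x. S \<subseteq> {x}"

definition closed_subgroups :: "('a, 'b) monoid_scheme \<Rightarrow> 'a topology \<Rightarrow> 'a set set" where
  "closed_subgroups G T = {H. subgroup H G \<and> closedin T H}"

definition open_normal_subgroups :: "('a, 'b) monoid_scheme \<Rightarrow> 'a topology \<Rightarrow> 'a set set" where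
  "open_normal_subgroups G T = {N. N \<lhd> G \<and> openin T N}"

text \<open>Infinite groups have \<open>order\<close> 0, so for \<open>p > 0\<close> the requirement below cannot hold
  of an infinite quotient.\<close>

locale pro_p_group = profinite_group +
  fixes p :: nat
  assumes order_quotient:
    "\<And>N. N \<in> open_normal_subgroups G T \<Longrightarrow> \<exists>k. order (G Mod N) = p ^ k"

definition just_infinite :: "('a, 'b) monoid_scheme \<Rightarrow> 'a topology \<Rightarrow> bool" where
  "just_infinite G T \<longleftrightarrow>
     infinite (carrier G) \<and>
     (\<forall>N. N \<lhd> G \<and> closedin T N \<and> N \<noteq> {\<one>\<^bsub>G\<^esub>} \<longrightarrow> openin T N)"


section \<open>The space of closed subgroups\<close>

definition subgroup_nhd ::
    "('a, 'b) monoid_scheme \<Rightarrow> 'a topology \<Rightarrow> 'a set \<Rightarrow> 'a set \<Rightarrow> 'a set set" where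
  "subgroup_nhd G T H N = {K \<in> closed_subgroups G T. K <#>\<^bsub>G\<^esub> N = H <#>\<^bsub>G\<^esub> N}"

definition subgroup_space :: "('a, 'b) monoid_scheme \<Rightarrow> 'a topology \<Rightarrow> 'a set topology" where
  "subgroup_space G T = topology_generated_by
     {subgroup_nhd G T H N | H N. H \<in> closed_subgroups G T \<and> N \<in> open_normal_subgroups G T}"

text \<open>The generating sets are not merely a subbase: those around a closed subgroup form a
  base of its open neighbourhoods.\<close>

lemma (in topological_group) topspace_subgroup_space:
  "topspace (subgroup_space G T) = closed_subgroups G T"
proof -
  have "carrier G \<in> open_normal_subgroups G T"
    using topspace_eq_carrier openin_topspace[of T] normal_self
    by (auto simp: open_normal_subgroups_def)
  moreover have "H \<in> subgroup_nhd G T H N" if "H \<in> closed_subgroups G T" for H N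
    using that by (simp add: subgroup_nhd_def)
  moreover have "subgroup_nhd G T H N \<subseteq> closed_subgroups G T" for H N
    by (auto simp: subgroup_nhd_def)
  ultimately show ?thesis
    unfolding subgroup_space_def topology_generated_by_topspace by blast
qed

lemma (in topological_group) subgroup_nhd_Int_subset:
  assumes H: "H \<in> closed_subgroups G T"
    and N: "N \<in> open_normal_subgroups G T" "M \<in> open_normal_subgroups G T"
  shows "N \<inter> M \<in> open_normal_subgroups G T"
    and "subgroup_nhd G T H (N \<inter> M) \<subseteq> subgroup_nhd G T H N \<inter> subgroup_nhd G T H M"
proof -
  have NM: "N \<lhd> G" "M \<lhd> G"
    using N by (auto simp: open_normal_subgroups_def)
  then have I: "subgroup (N \<inter> M) G"
    using subgroups_Inter_pair normal_imp_subgroup by blast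
  show "N \<inter> M \<in> open_normal_subgroups G T"
    using N normal_subgroup_intersect[OF NM] by (auto simp: open_normal_subgroups_def)
  have absorb: "(K <#> (N \<inter> M)) <#> L = K <#> L"
    if "subgroup L G" "N \<inter> M \<subseteq> L" "K \<subseteq> carrier G" for K L
  proof -
    have L: "L \<subseteq> carrier G" using that(1) subgroup.subset by auto
    have "(N \<inter> M) <#> L = L"
    proof
      show "(N \<inter> M) <#> L \<subseteq> L"
        using that(1,2) subgroup.m_closed by (fastforce simp: set_mult_def)
      show "L \<subseteq> (N \<inter> M) <#> L"
        using subgroup.one_closed[OF I] L by (force simp: set_mult_def)
    qed
    then show ?thesis
      using set_mult_assoc[of K "N \<inter> M" L] that L by auto
  qed
  have "K <#> L = H <#> L"
    if K: "K \<in> subgroup_nhd G T H (N \<inter> M)" and L: "subgroup L G" "N \<inter> M \<subseteq> L" for K L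
  proof -
    have "K \<subseteq> carrier G" "H \<subseteq> carrier G" "K <#> (N \<inter> M) = H <#> (N \<inter> M)"
      using K H by (auto simp: subgroup_nhd_def closed_subgroups_def dest: subgroup.mem_carrier)
    then show ?thesis
      using absorb[OF L, of K] absorb[OF L, of H] by simp
  qed
  from this[OF _ normal_imp_subgroup[OF NM(1)]] this[OF _ normal_imp_subgroup[OF NM(2)]]
  show "subgroup_nhd G T H (N \<inter> M) \<subseteq> subgroup_nhd G T H N \<inter> subgroup_nhd G T H M"
    by (auto simp: subgroup_nhd_def)
qed

lemma (in topological_group) openin_subgroup_space_iff:
  "openin (subgroup_space G T) U \<longleftrightarrow>
     U \<subseteq> closed_subgroups G T \<and>
     (\<forall>H\<in>U. \<exists>N\<in>open_normal_subgroups G T. subgroup_nhd G T H N \<subseteq> U)"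
  (is "?L \<longleftrightarrow> ?R")
proof
  assume ?L
  then have sub: "U \<subseteq> closed_subgroups G T"
    using openin_subset topspace_subgroup_space by metis
  from \<open>?L\<close> have "generate_topology_on {subgroup_nhd G T H N | H N.
      H \<in> closed_subgroups G T \<and> N \<in> open_normal_subgroups G T} U"
    by (simp add: subgroup_space_def openin_topology_generated_by_iff)
  then have "\<forall>H\<in>U \<inter> closed_subgroups G T. \<exists>N\<in>open_normal_subgroups G T. subgroup_nhd G T H N \<subseteq> U"
  proof induction
    case Empty
    then show ?case by simp
  next
    case (Int a b)
    show ?case
    proof
      fix H assume H: "H \<in> (a \<inter> b) \<inter> closed_subgroups G T"
      then obtain N M where "N \<in> open_normal_subgroups G T" "subgroup_nhd G T H N \<subseteq> a"
          "M \<in> open_normal_subgroups G T" "subgroup_nhd G T H M \<subseteq> b"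
        using Int.IH by blast
      then show "\<exists>N\<in>open_normal_subgroups G T. subgroup_nhd G T H N \<subseteq> a \<inter> b"
        using subgroup_nhd_Int_subset[of H N M] H by blast
    qed
  next
    case (UN K)
    then show ?case by blast
  next
    case (Basis s)
    then show ?case by (fastforce simp: subgroup_nhd_def)
  qed
  with sub show ?R by blast
next
  assume R: ?R
  let ?B = "{subgroup_nhd G T H N | H N.
      H \<in> closed_subgroups G T \<and> N \<in> open_normal_subgroups G T}"
  have "U = \<Union>{B \<in> ?B. B \<subseteq> U}"
  proof
    show "U \<subseteq> \<Union>{B \<in> ?B. B \<subseteq> U}"
    proof
      fix H assume H: "H \<in> U"
      then obtain N where "N \<in> open_normal_subgroups G T" "subgroup_nhd G T H N \<subseteq> U"
        using R by blast
      moreover have "H \<in> closed_subgroups G T" using R H by blast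
      moreover from this have "H \<in> subgroup_nhd G T H N" by (simp add: subgroup_nhd_def)
      ultimately show "H \<in> \<Union>{B \<in> ?B. B \<subseteq> U}" by blast
    qed
  qed auto
  moreover have "openin (subgroup_space G T) (\<Union>{B \<in> ?B. B \<subseteq> U})"
    unfolding subgroup_space_def by (rule openin_Union) (auto intro: topology_generated_by_Basis)
  ultimately show ?L by simp
qed


section \<open>Pelczynski space\<close>

text \<open>A pair \<open>(a, b)\<close> stands for the closed interval \<open>{a..b}\<close> that is
  present after \<open>n\<close> steps of the middle-third construction.\<close>

fun cantor_intervals :: "nat \<Rightarrow> (real \<times> real) set" where
  "cantor_intervals 0 = {(0, 1)}"
| "cantor_intervals (Suc n) =
     (\<Union>(a, b)\<in>cantor_intervals n. {(a, (2 * a + b) / 3), ((a + 2 * b) / 3, b)})"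

definition cantor_set :: "real set" where
  "cantor_set = (\<Inter>n. \<Union>(a, b)\<in>cantor_intervals n. {a..b})"

text \<open>A pair \<open>(c, d)\<close> here stands for the deleted open interval \<open>{c<..<d}\<close>.\<close>

definition deleted_intervals :: "(real \<times> real) set" where
  "deleted_intervals =
     (\<Union>n. \<Union>(a, b)\<in>cantor_intervals n. {((2 * a + b) / 3, (a + 2 * b) / 3)})"

definition pelczynski_set :: "real set" where
  "pelczynski_set = cantor_set \<union> (\<lambda>(c, d). midpoint c d) ` deleted_intervals"

abbreviation pelczynski_space :: "real topology" where
  "pelczynski_space \<equiv> top_of_set pelczynski_set"

end

theory Submission
  imports Defs "HOL-Algebra.Group_Action" "HOL-Algebra.Zassenhaus"
begin

text \<open>Two compact Hausdorff spaces with countable clopen bases are homeomorphic as soon as, in both,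
  the isolated points are dense and the remaining points form a nonempty set without isolated
  points: clopen sets are matched by cardinality in a back-and-forth argument. \<open>\<S>(G)\<close> is such a space.
  Insolubility makes the closure of the derived subgroup of an open normal subgroup \<open>N\<close> open again,
  and it is contained in the Frattini subgroup of \<open>N\<close>. Iterating gives a countable base at \<open>\<one>\<close>, and
  it follows that every open subgroup is an isolated point of \<open>\<S>(G)\<close>; open subgroups are clearly
  dense. A closed subgroup isolated among the subgroups that are not open would contain the derived
  subgroup of an open subgroup, and hence be open after all.\<close>

section \<open>Back and forth between clopen algebras\<close>

text \<open>Cardinality is a sufficient invariant because compactness makes every clopen set of
  isolated points finite: an infinite clopen set meets the perfect part, can be cut into two
  infinite clopen pieces, and has finite clopen subsets of every size. The Frattini inclusion comes
  from finite \<open>p\<close>-groups, where maximal subgroups are normal with commutative quotient.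
  Insolubility acts through a single fact: the quotient by an open normal subgroup is a finite
  \<open>p\<close>-group, hence soluble, so no open normal subgroup can be abelian. The obstacle is
  that a derived subgroup is not known to be closed, while just-infiniteness speaks of closed normal
  subgroups only. Closures are therefore taken at each step of the derived series; this is harmless
  because a subgroup and its closure have the same image in every quotient by an open normal
  subgroup.\<close>

definition clopenin :: "'a topology \<Rightarrow> 'a set \<Rightarrow> bool" where
  "clopenin X C \<longleftrightarrow> openin X C \<and> closedin X C"

lemma clopenin_topspace: "clopenin X (topspace X)"
  by (simp add: clopenin_def)

lemma clopenin_empty: "clopenin X {}"
  by (simp add: clopenin_def)

lemma clopenin_Int: "clopenin X A \<Longrightarrow> clopenin X B \<Longrightarrow> clopenin X (A \<inter> B)"
  by (auto simp: clopenin_def)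

lemma clopenin_Diff: "clopenin X A \<Longrightarrow> clopenin X B \<Longrightarrow> clopenin X (A - B)"
  by (auto simp: clopenin_def)

lemma clopenin_Un: "clopenin X A \<Longrightarrow> clopenin X B \<Longrightarrow> clopenin X (A \<union> B)"
  by (auto simp: clopenin_def)

lemma clopenin_subset: "clopenin X A \<Longrightarrow> A \<subseteq> topspace X"
  by (simp add: clopenin_def openin_subset)

definition clopen_base :: "'a topology \<Rightarrow> 'a set set \<Rightarrow> bool" where
  "clopen_base X \<A> \<longleftrightarrow> (\<forall>A\<in>\<A>. clopenin X A) \<and>
     (\<forall>U x. openin X U \<and> x \<in> U \<longrightarrow> (\<exists>A\<in>\<A>. x \<in> A \<and> A \<subseteq> U))"

lemma clopen_baseD:
  "clopen_base X \<A> \<Longrightarrow> openin X U \<Longrightarrow> x \<in> U \<Longrightarrow> \<exists>A\<in>\<A>. x \<in> A \<and> A \<subseteq> U"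
  by (simp add: clopen_base_def)

lemma clopen_base_clopenin: "clopen_base X \<A> \<Longrightarrow> A \<in> \<A> \<Longrightarrow> clopenin X A"
  by (simp add: clopen_base_def)

lemma clopen_base_separates:
  assumes "Hausdorff_space X" "clopen_base X \<A>" "x \<in> topspace X" "y \<in> topspace X" "x \<noteq> y"
  shows "\<exists>A\<in>\<A>. x \<in> A \<and> y \<notin> A"
proof -
  obtain U V where "openin X U" "openin X V" "x \<in> U" "y \<in> V" "disjnt U V"
    using assms unfolding Hausdorff_space_def by metis
  moreover from this obtain A where "A \<in> \<A>" "x \<in> A" "A \<subseteq> U"
    using clopen_baseD[OF assms(2)] by metis
  ultimately show ?thesis by (auto simp: disjnt_iff)
qed

text \<open>This is the extension property of a back-and-forth system, read on clopen sets. The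
  cutting set \<open>C\<close> may stick out of \<open>A\<close>; only its trace on \<open>A\<close>
  matters. The emptiness clause ensures that a block inhabited on one side has an inhabited
  partner.\<close>

definition back_and_forth :: "'a topology \<Rightarrow> 'b topology \<Rightarrow> ('a set \<Rightarrow> 'b set \<Rightarrow> bool) \<Rightarrow> bool" where
  "back_and_forth X Y R \<longleftrightarrow> R (topspace X) (topspace Y) \<and>
     (\<forall>A B. R A B \<longrightarrow> clopenin X A \<and> clopenin Y B \<and> (A = {} \<longleftrightarrow> B = {})) \<and>
     (\<forall>A B C. R A B \<and> clopenin X C \<longrightarrow> (\<exists>D. R (A \<inter> C) (B \<inter> D) \<and> R (A - C) (B - D))) \<and>
     (\<forall>A B D. R A B \<and> clopenin Y D \<longrightarrow> (\<exists>C. R (A \<inter> C) (B \<inter> D) \<and> R (A - C) (B - D)))"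

lemma back_and_forth_conversep:
  "back_and_forth X Y R \<Longrightarrow> back_and_forth Y X R\<inverse>\<inverse>"
  by (simp add: back_and_forth_def)

text \<open>One stage of the construction: for a back-and-forth \<open>R\<close>, the blocks of a
  clopen partition of \<open>X\<close> are paired with those of a clopen partition of
  \<open>Y\<close>. Cutting along a set that misses a block creates the pair
  \<open>({}, {})\<close>, which is why uniqueness is asked only of blocks that meet.\<close>

definition matching ::
    "'a topology \<Rightarrow> 'b topology \<Rightarrow> ('a set \<Rightarrow> 'b set \<Rightarrow> bool) \<Rightarrow> ('a set \<Rightarrow> 'b set \<Rightarrow> bool) \<Rightarrow> bool" where
  "matching X Y R F \<longleftrightarrow> (\<forall>A B. F A B \<longrightarrow> R A B) \<and>
     (\<forall>x\<in>topspace X. \<exists>A B. F A B \<and> x \<in> A) \<and> (\<forall>y\<in>topspace Y. \<exists>A B. F A B \<and> y \<in> B) \<and>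
     (\<forall>A B A' B'. F A B \<and> F A' B' \<and> (A \<inter> A' \<noteq> {} \<or> B \<inter> B' \<noteq> {}) \<longrightarrow> A = A' \<and> B = B')"

lemma matchingD: "matching X Y R F \<Longrightarrow> F A B \<Longrightarrow> R A B"
  by (simp add: matching_def)

lemma matching_unique:
  "matching X Y R F \<Longrightarrow> F A B \<Longrightarrow> F A' B' \<Longrightarrow> A \<inter> A' \<noteq> {} \<or> B \<inter> B' \<noteq> {} \<Longrightarrow> A = A' \<and> B = B'"
  by (simp add: matching_def)

lemma matching_conversep:
  assumes m: "matching X Y R F" shows "matching Y X R\<inverse>\<inverse> F\<inverse>\<inverse>"
  unfolding matching_def conversep_iff
proof (intro conjI ballI allI impI)
  show "R A B" if "F A B" for A B using matchingD[OF m that] .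
  show "\<exists>B A. F A B \<and> y \<in> B" if "y \<in> topspace Y" for y
    using m that unfolding matching_def by meson
  show "\<exists>B A. F A B \<and> x \<in> A" if "x \<in> topspace X" for x
    using m that unfolding matching_def by meson
  fix B A B' A' assume "F A B \<and> F A' B' \<and> (B \<inter> B' \<noteq> {} \<or> A \<inter> A' \<noteq> {})"
  then have "F A B" "F A' B'" "A \<inter> A' \<noteq> {} \<or> B \<inter> B' \<noteq> {}" by auto
  then show "B = B'" "A = A'"
    using matching_unique[OF m] by simp_all
qed

text \<open>One coarser pair has to contain both coordinates, so that when the blocks around a point
  of \<open>X\<close> shrink, their partners in \<open>Y\<close> shrink with them.\<close>

definition refines :: "('a set \<Rightarrow> 'b set \<Rightarrow> bool) \<Rightarrow> ('a set \<Rightarrow> 'b set \<Rightarrow> bool) \<Rightarrow> bool" where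
  "refines F' F \<longleftrightarrow> (\<forall>A' B'. F' A' B' \<longrightarrow> (\<exists>A B. F A B \<and> A' \<subseteq> A \<and> B' \<subseteq> B))"

lemma refines_conversep: "refines F' F \<Longrightarrow> refines F'\<inverse>\<inverse> F\<inverse>\<inverse>"
  unfolding refines_def conversep_iff by blast

lemma refines_trans: "refines F'' F' \<Longrightarrow> refines F' F \<Longrightarrow> refines F'' F"
  unfolding refines_def by (meson order_trans)

text \<open>Each pair \<open>(A, B)\<close> is cut separately: the clause of \<open>R\<close> for
  clopen subsets of \<open>X\<close> supplies a set \<open>d A B\<close> that does to
  \<open>B\<close> what \<open>C\<close> does to \<open>A\<close>.\<close>

lemma matching_refine_left:
  assumes R: "back_and_forth X Y R" and F: "matching X Y R F" and C: "clopenin X C"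
  obtains F' where "matching X Y R F'" "refines F' F"
    and "\<And>A B. F' A B \<Longrightarrow> A \<subseteq> C \<or> A \<inter> C = {}"
proof -
  have "\<forall>A B. \<exists>D. F A B \<longrightarrow> R (A \<inter> C) (B \<inter> D) \<and> R (A - C) (B - D)"
    using R F C unfolding back_and_forth_def matching_def by meson
  then obtain d where d: "\<And>A B. F A B \<Longrightarrow> R (A \<inter> C) (B \<inter> d A B)"
    "\<And>A B. F A B \<Longrightarrow> R (A - C) (B - d A B)"
    by metis
  define F' where "F' = (\<lambda>A' B'. \<exists>A B. F A B \<and>
    (A' = A \<inter> C \<and> B' = B \<inter> d A B \<or> A' = A - C \<and> B' = B - d A B))"
  have F'I: "F' (A \<inter> C) (B \<inter> d A B)" "F' (A - C) (B - d A B)" if "F A B" for A B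
    using that unfolding F'_def by blast+
  show thesis
  proof
    show "matching X Y R F'"
      unfolding matching_def
    proof (intro conjI allI impI ballI)
      fix A B assume "F' A B" then show "R A B"
        using d unfolding F'_def by blast
    next
      fix x assume "x \<in> topspace X"
      then obtain A B where "F A B" "x \<in> A" using F unfolding matching_def by meson
      then show "\<exists>A B. F' A B \<and> x \<in> A"
        using F'I[of A B] by (cases "x \<in> C") blast+
    next
      fix y assume "y \<in> topspace Y"
      then obtain A B where "F A B" "y \<in> B" using F unfolding matching_def by meson
      then show "\<exists>A B. F' A B \<and> y \<in> B"
        using F'I[of A B] by (cases "y \<in> d A B") blast+
    next
      fix A1 B1 A2 B2
      assume *: "F' A1 B1 \<and> F' A2 B2 \<and> (A1 \<inter> A2 \<noteq> {} \<or> B1 \<inter> B2 \<noteq> {})"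
      then obtain A B where AB: "F A B"
          "A1 = A \<inter> C \<and> B1 = B \<inter> d A B \<or> A1 = A - C \<and> B1 = B - d A B"
        unfolding F'_def by blast
      from * obtain A' B' where AB': "F A' B'"
          "A2 = A' \<inter> C \<and> B2 = B' \<inter> d A' B' \<or> A2 = A' - C \<and> B2 = B' - d A' B'"
        unfolding F'_def by blast
      have "A \<inter> A' \<noteq> {} \<or> B \<inter> B' \<noteq> {}" using * AB(2) AB'(2) by blast
      then have "A = A'" "B = B'" using F AB(1) AB'(1) unfolding matching_def by meson+
      with * AB(2) AB'(2) show "A1 = A2" "B1 = B2" by blast+
    qed
    show "refines F' F"
      unfolding refines_def F'_def by blast
    show "A \<subseteq> C \<or> A \<inter> C = {}" if "F' A B" for A B
      using that unfolding F'_def by blast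
  qed
qed

text \<open>The cut by \<open>D\<close> is \<open>matching_refine_left\<close> for the converse
  relations. It preserves the effect of the earlier cut by \<open>C\<close>, since blocks only
  shrink.\<close>

lemma matching_refine:
  assumes R: "back_and_forth X Y R" and F: "matching X Y R F"
    and C: "clopenin X C" and D: "clopenin Y D"
  obtains F' where "matching X Y R F'" "refines F' F"
    and "\<And>A B. F' A B \<Longrightarrow> A \<subseteq> C \<or> A \<inter> C = {}" "\<And>A B. F' A B \<Longrightarrow> B \<subseteq> D \<or> B \<inter> D = {}"
proof -
  obtain F1 where F1: "matching X Y R F1" "refines F1 F"
      "\<And>A B. F1 A B \<Longrightarrow> A \<subseteq> C \<or> A \<inter> C = {}"
    by (rule matching_refine_left[OF R F C]) blast
  obtain F2 where F2: "matching Y X R\<inverse>\<inverse> F2" "refines F2 F1\<inverse>\<inverse>"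
      "\<And>B A. F2 B A \<Longrightarrow> B \<subseteq> D \<or> B \<inter> D = {}"
    by (rule matching_refine_left[OF back_and_forth_conversep[OF R] matching_conversep[OF F1(1)] D]) blast
  show thesis
  proof
    show "matching X Y R F2\<inverse>\<inverse>" using matching_conversep[OF F2(1)] by simp
    have r: "refines F2\<inverse>\<inverse> F1" using refines_conversep[OF F2(2)] by simp
    then show "refines F2\<inverse>\<inverse> F" using F1(2) refines_trans by blast
    show "A \<subseteq> C \<or> A \<inter> C = {}" if "F2\<inverse>\<inverse> A B" for A B
      using r that F1(3) unfolding refines_def by (meson disjoint_iff order_trans subsetD)
    show "B \<subseteq> D \<or> B \<inter> D = {}" if "F2\<inverse>\<inverse> A B" for A B
      using F2(3) that by simp
  qed
qed

text \<open>The blocks containing a point \<open>x\<close> have partners in \<open>Y\<close> that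
  decrease with the stage, and compactness puts a point into all of them. Two such points would be
  separated by some \<open>b m\<close>, which stage \<open>Suc m\<close> has decided, so the point
  is unique; the same fact makes the limit map continuous. The graph is described symmetrically in
  \<open>x\<close> and \<open>y\<close>, so that the converse matchings can produce the inverse
  map.\<close>

lemma matching_sequence_limit:
  fixes b :: "nat \<Rightarrow> 'b set"
  assumes X: "compact_space Y" "Hausdorff_space Y" "clopen_base Y (range b)"
    and R: "back_and_forth X Y R"
    and F: "\<And>n. matching X Y R (F n)" "\<And>n. refines (F (Suc n)) (F n)"
    and dec: "\<And>n A B. F (Suc n) A B \<Longrightarrow> B \<subseteq> b n \<or> B \<inter> b n = {}"
  obtains f where "continuous_map X Y f"
    "\<And>x y. x \<in> topspace X \<Longrightarrow> y \<in> topspace Y \<Longrightarrow>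
       f x = y \<longleftrightarrow> (\<forall>n. \<exists>A B. F n A B \<and> x \<in> A \<and> y \<in> B)"
proof -
  have same: "A = A' \<and> B = B'" if "F n A B" "F n A' B'" "A \<inter> A' \<noteq> {} \<or> B \<inter> B' \<noteq> {}" for n A B A' B'
    using F(1)[of n] that unfolding matching_def by meson
  have clopen: "clopenin X A" "clopenin Y B" "A = {} \<longleftrightarrow> B = {}" if "F n A B" for n A B
  proof -
    have "R A B" using F(1)[of n] that by (rule matchingD)
    then show "clopenin X A" "clopenin Y B" "A = {} \<longleftrightarrow> B = {}"
      using R unfolding back_and_forth_def by simp_all
  qed
  have ex: "\<exists>y\<in>topspace Y. \<forall>n. \<exists>A B. F n A B \<and> x \<in> A \<and> y \<in> B" if x: "x \<in> topspace X" for x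
  proof -
    have "\<forall>n. \<exists>A B. F n A B \<and> x \<in> A"
      using F(1) x unfolding matching_def by meson
    then obtain A B where AB: "\<And>n. F n (A n) (B n)" "\<And>n. x \<in> A n" by metis
    have dec': "B (Suc n) \<subseteq> B n" for n
    proof -
      obtain A' B' where "F n A' B'" "A (Suc n) \<subseteq> A'" "B (Suc n) \<subseteq> B'"
        using F(2)[of n] AB(1)[of "Suc n"] unfolding refines_def by blast
      moreover from this have "B' = B n"
        using same[of n A' B' "A n" "B n"] AB by blast
      ultimately show ?thesis by simp
    qed
    have "(\<Inter>n. B n) \<noteq> {}"
    proof (rule compact_space_imp_nest[OF X(1)])
      show "closedin Y (B n)" for n using clopen(2)[OF AB(1)] by (simp add: clopenin_def)
      show "B n \<noteq> {}" for n using clopen(3)[OF AB(1)] AB(2) by blast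
      show "decseq B" using dec' by (rule decseq_SucI)
    qed
    then obtain y where "\<And>n. y \<in> B n" by blast
    then show ?thesis
      using AB clopenin_subset[OF clopen(2)[OF AB(1)]] by blast
  qed
  have unique: "y = y'"
    if x: "x \<in> topspace X" and y: "y \<in> topspace Y" "\<forall>n. \<exists>A B. F n A B \<and> x \<in> A \<and> y \<in> B"
      and y': "y' \<in> topspace Y" "\<forall>n. \<exists>A B. F n A B \<and> x \<in> A \<and> y' \<in> B" for x y y'
  proof (rule ccontr)
    assume "y \<noteq> y'"
    then obtain m where m: "y \<in> b m" "y' \<notin> b m"
      using clopen_base_separates[OF X(2,3) y(1) y'(1)] by auto
    obtain A B A' B' where "F (Suc m) A B" "x \<in> A" "y \<in> B" "F (Suc m) A' B'" "x \<in> A'" "y' \<in> B'"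
      using spec[OF y(2), of "Suc m"] spec[OF y'(2), of "Suc m"] by blast
    moreover from this have "B = B'" using same[of "Suc m" A B A' B'] by blast
    ultimately show False using dec[of m A B] m by blast
  qed
  obtain f where f: "\<And>x. x \<in> topspace X \<Longrightarrow> f x \<in> topspace Y"
      "\<And>x n. x \<in> topspace X \<Longrightarrow> \<exists>A B. F n A B \<and> x \<in> A \<and> f x \<in> B"
    using ex by metis
  show thesis
  proof
    show "continuous_map X Y f"
      unfolding continuous_map
    proof (intro conjI allI impI)
      show "f ` topspace X \<subseteq> topspace Y" using f by blast
      fix U assume U: "openin Y U"
      show "openin X {x \<in> topspace X. f x \<in> U}"
      proof (subst openin_subopen, safe)
        fix x assume x: "x \<in> topspace X" "f x \<in> U"
        then obtain m where m: "f x \<in> b m" "b m \<subseteq> U"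
          using clopen_baseD[OF X(3) U] by blast
        obtain A B where AB: "F (Suc m) A B" "x \<in> A" "f x \<in> B" using f(2)[OF x(1), of "Suc m"] by auto
        have "B \<subseteq> U" using dec[OF AB(1)] m AB(3) by blast
        have "A \<subseteq> topspace X" using clopen[OF AB(1)] clopenin_subset by blast
        have "f x' \<in> U" if x': "x' \<in> A" for x'
        proof -
          obtain A' B' where "F (Suc m) A' B'" "x' \<in> A'" "f x' \<in> B'"
            using f(2)[OF subsetD[OF \<open>A \<subseteq> topspace X\<close> x'], of "Suc m"] by auto
          moreover from this have "B = B'" using same[OF AB(1), of A' B'] x' by blast
          ultimately show ?thesis using \<open>B \<subseteq> U\<close> by blast
        qed
        then show "\<exists>T. openin X T \<and> x \<in> T \<and> T \<subseteq> {x \<in> topspace X. f x \<in> U}"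
          using clopen(1)[OF AB(1)] AB(2) \<open>A \<subseteq> topspace X\<close>
          by (intro exI[of _ A]) (auto simp: clopenin_def)
      qed
    qed
    show "f x = y \<longleftrightarrow> (\<forall>n. \<exists>A B. F n A B \<and> x \<in> A \<and> y \<in> B)"
      if "x \<in> topspace X" "y \<in> topspace Y" for x y
    proof
      assume "f x = y"
      then show "\<forall>n. \<exists>A B. F n A B \<and> x \<in> A \<and> y \<in> B" using f(2)[OF that(1)] by simp
    next
      assume y: "\<forall>n. \<exists>A B. F n A B \<and> x \<in> A \<and> y \<in> B"
      show "f x = y"
        by (rule unique[OF that(1) f(1)[OF that(1)] _ that(2) y]) (use f(2)[OF that(1)] in simp)
    qed
  qed
qed

text \<open>Stage \<open>Suc n\<close> decides both \<open>a n\<close> and \<open>b n\<close>, so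
  the limit exists in both directions. The graphs of \<open>f\<close> and \<open>g\<close> are given
  by the same condition on pairs of blocks, hence the two maps are mutually inverse.\<close>

theorem back_and_forth_imp_homeomorphic_space:
  fixes a :: "nat \<Rightarrow> 'a set" and b :: "nat \<Rightarrow> 'b set"
  assumes X: "compact_space X" "Hausdorff_space X" "clopen_base X (range a)"
    and Y: "compact_space Y" "Hausdorff_space Y" "clopen_base Y (range b)"
    and R: "back_and_forth X Y R"
  shows "X homeomorphic_space Y"
proof -
  have ab: "clopenin X (a n)" "clopenin Y (b n)" for n
    using clopen_base_clopenin[OF X(3)] clopen_base_clopenin[OF Y(3)] by auto
  have "\<exists>F. \<forall>n. matching X Y R (F n) \<and> (refines (F (Suc n)) (F n) \<and>
    (\<forall>A B. F (Suc n) A B \<longrightarrow> (A \<subseteq> a n \<or> A \<inter> a n = {}) \<and> (B \<subseteq> b n \<or> B \<inter> b n = {})))"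
  proof (rule dependent_nat_choice)
    show "\<exists>F. matching X Y R F"
      by (rule exI[of _ "\<lambda>A B. A = topspace X \<and> B = topspace Y"])
        (use R in \<open>auto simp: matching_def back_and_forth_def\<close>)
    show "\<exists>F'. matching X Y R F' \<and> refines F' F \<and>
      (\<forall>A B. F' A B \<longrightarrow> (A \<subseteq> a n \<or> A \<inter> a n = {}) \<and> (B \<subseteq> b n \<or> B \<inter> b n = {}))"
      if "matching X Y R F" for F n
      by (rule matching_refine[OF R that ab]) blast
  qed
  then obtain F where F: "\<And>n. matching X Y R (F n)" "\<And>n. refines (F (Suc n)) (F n)"
      "\<And>n A B. F (Suc n) A B \<Longrightarrow> A \<subseteq> a n \<or> A \<inter> a n = {}"
      "\<And>n A B. F (Suc n) A B \<Longrightarrow> B \<subseteq> b n \<or> B \<inter> b n = {}"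
    by metis
  obtain f where f: "continuous_map X Y f"
    "\<And>x y. x \<in> topspace X \<Longrightarrow> y \<in> topspace Y \<Longrightarrow>
       f x = y \<longleftrightarrow> (\<forall>n. \<exists>A B. F n A B \<and> x \<in> A \<and> y \<in> B)"
    by (rule matching_sequence_limit[where F = F, OF Y R F(1) F(2) F(4)]) blast+
  obtain g where g: "continuous_map Y X g"
    "\<And>y x. y \<in> topspace Y \<Longrightarrow> x \<in> topspace X \<Longrightarrow>
       g y = x \<longleftrightarrow> (\<forall>n. \<exists>B A. (F n)\<inverse>\<inverse> B A \<and> y \<in> B \<and> x \<in> A)"
  proof (rule matching_sequence_limit[where F = "\<lambda>n. (F n)\<inverse>\<inverse>", OF X back_and_forth_conversep[OF R]])
    show "matching Y X R\<inverse>\<inverse> (F n)\<inverse>\<inverse>" for n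
      by (rule matching_conversep[OF F(1)])
    show "refines (F (Suc n))\<inverse>\<inverse> (F n)\<inverse>\<inverse>" for n
      by (rule refines_conversep[OF F(2)])
    show "A \<subseteq> a n \<or> A \<inter> a n = {}" if "(F (Suc n))\<inverse>\<inverse> B A" for n B A
      by (rule F(3)) (use that in simp)
    fix g assume "continuous_map Y X g"
      "\<And>y x. y \<in> topspace Y \<Longrightarrow> x \<in> topspace X \<Longrightarrow>
         g y = x \<longleftrightarrow> (\<forall>n. \<exists>B A. (F n)\<inverse>\<inverse> B A \<and> y \<in> B \<and> x \<in> A)"
    then show thesis by (rule that)
  qed
  have fg: "\<And>x. x \<in> topspace X \<Longrightarrow> f x \<in> topspace Y" "\<And>y. y \<in> topspace Y \<Longrightarrow> g y \<in> topspace X"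
    using f(1) g(1) by (auto simp: continuous_map_def)
  have eq: "f x = y \<longleftrightarrow> g y = x" if "x \<in> topspace X" "y \<in> topspace Y" for x y
    using f(2)[OF that] g(2)[OF that(2,1)] unfolding conversep_iff by meson
  have "homeomorphic_maps X Y f g"
    unfolding homeomorphic_maps_def using f(1) g(1) fg eq by auto
  then show ?thesis by (auto simp: homeomorphic_space_def)
qed

text \<open>The clauses determine \<open>D\<close>: its points are isolated, and an isolated point
  outside \<open>D\<close> would contradict the last clause. So \<open>D\<close> is the set of all
  isolated points.\<close>

definition pelczynski_like :: "'a topology \<Rightarrow> bool" where
  "pelczynski_like X \<longleftrightarrow> compact_space X \<and> Hausdorff_space X \<and>
     (\<exists>\<A>. countable \<A> \<and> clopen_base X \<A>) \<and>
     (\<exists>D. topspace X - D \<noteq> {} \<and> (\<forall>d\<in>D. openin X {d}) \<and>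
        (\<forall>U. openin X U \<and> U \<noteq> {} \<longrightarrow> U \<inter> D \<noteq> {}) \<and>
        (\<forall>U x. openin X U \<and> x \<in> U - D \<longrightarrow> (\<exists>y\<in>U - D. y \<noteq> x)))"

lemma pelczynski_likeE:
  assumes "pelczynski_like X"
  obtains \<A> D where "compact_space X" "Hausdorff_space X" "countable \<A>" "clopen_base X \<A>"
    "topspace X - D \<noteq> {}" "\<forall>d\<in>D. openin X {d}"
    "\<forall>U. openin X U \<and> U \<noteq> {} \<longrightarrow> U \<inter> D \<noteq> {}"
    "\<forall>U x. openin X U \<and> x \<in> U - D \<longrightarrow> (\<exists>y\<in>U - D. y \<noteq> x)"
  using assms unfolding pelczynski_like_def by (elim conjE exE) (rule that)

text \<open>Finite sets are closed in a Hausdorff space, so removing \<open>B - D\<close> from the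
  open set \<open>B\<close> leaves an open set.\<close>

lemma clopenin_subset_finite:
  assumes X: "Hausdorff_space X" and B: "clopenin X B" "finite B" and D: "D \<subseteq> B"
  shows "clopenin X D"
proof -
  have cl: "closedin X D'" if "D' \<subseteq> B" for D'
    using closedin_Hausdorff_finite[OF X] that B clopenin_subset finite_subset
    by (metis order_trans)
  have "D = B - (B - D)" using D by blast
  then have "openin X D" using cl[of "B - D"] B(1) unfolding clopenin_def
    by (metis Diff_subset openin_diff)
  then show ?thesis using cl[OF D] by (simp add: clopenin_def)
qed

lemma pelczynski_like_infinite:
  assumes X: "pelczynski_like X" shows "infinite (topspace X)"
proof
  assume fin: "finite (topspace X)"
  obtain D where H: "Hausdorff_space X" and D: "topspace X - D \<noteq> {}"
    "\<forall>U x. openin X U \<and> x \<in> U - D \<longrightarrow> (\<exists>y\<in>U - D. y \<noteq> x)"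
    by (rule pelczynski_likeE[OF X]) blast
  from D obtain x where x: "x \<in> topspace X - D" by blast
  have "clopenin X {x}"
    using clopenin_subset_finite[OF H clopenin_topspace fin] x by blast
  then show False using D(2)[rule_format, of "{x}" x] x by (auto simp: clopenin_def)
qed

text \<open>The subset grows one point at a time: the remainder \<open>B - D\<close> is open and
  nonempty, so by density it contains an isolated point, and that point is clopen.\<close>

lemma pelczynski_like_finite_clopen_subset:
  assumes X: "pelczynski_like X" and B: "clopenin X B" "infinite B"
  shows "\<exists>D\<subseteq>B. clopenin X D \<and> finite D \<and> card D = n"
proof (induction n)
  case 0
  show ?case using clopenin_empty by (intro exI[of _ "{}"]) auto
next
  case (Suc n)
  then obtain D where D: "D \<subseteq> B" "clopenin X D" "finite D" "card D = n" by blast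
  obtain I where I: "Hausdorff_space X" "\<forall>d\<in>I. openin X {d}"
      "\<forall>U. openin X U \<and> U \<noteq> {} \<longrightarrow> U \<inter> I \<noteq> {}"
    by (rule pelczynski_likeE[OF X]) blast
  have "clopenin X (B - D)" using B D clopenin_Diff by blast
  moreover have "B - D \<noteq> {}" using Diff_infinite_finite[OF D(3) B(2)] by (metis finite.emptyI)
  ultimately obtain d where d: "d \<in> B - D" "d \<in> I" using I(3)[rule_format, of "B - D"] by (auto simp: clopenin_def)
  have "clopenin X {d}"
    using bspec[OF I(2) d(2)] closedin_Hausdorff_singleton[OF I(1)] d(1) clopenin_subset[OF B(1)]
    by (auto simp: clopenin_def)
  then have "clopenin X (insert d D)" using clopenin_Un[OF _ D(2)] by force
  then show ?case
    using D d by (intro exI[of _ "insert d D"]) auto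
qed

text \<open>A clopen set with a point outside \<open>I\<close> is infinite, so it is enough to
  separate two such points of \<open>B\<close> by a clopen set. Compactness supplies the first of
  them, the absence of isolated points outside \<open>I\<close> the second.\<close>

lemma pelczynski_like_split:
  assumes X: "pelczynski_like X" and B: "clopenin X B" "infinite B"
  obtains D where "clopenin X D" "infinite (B \<inter> D)" "infinite (B - D)"
proof -
  obtain \<A> I where I: "compact_space X" "Hausdorff_space X" "clopen_base X \<A>"
      "\<forall>d\<in>I. openin X {d}"
      "\<forall>U x. openin X U \<and> x \<in> U - I \<longrightarrow> (\<exists>y\<in>U - I. y \<noteq> x)"
    by (rule pelczynski_likeE[OF X]) blast
  have inf: "infinite C" if C: "clopenin X C" "x \<in> C" "x \<notin> I" for C x
  proof
    assume "finite C"
    then have "openin X {x}"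
      using clopenin_subset_finite[OF I(2) C(1), of "{x}"] C(2) by (auto simp: clopenin_def)
    then show False using I(5)[rule_format, of "{x}" x] C(3) by auto
  qed
  \<comment> \<open>Otherwise the singletons would form an open cover of the compact set
    \<open>B\<close>, and a finite subcover would make \<open>B\<close> finite.\<close>
  have "\<not> B \<subseteq> I"
  proof
    assume "B \<subseteq> I"
    have "compactin X B" using B(1) I(1) closedin_compact_space by (auto simp: clopenin_def)
    moreover have "\<And>U. U \<in> (\<lambda>b. {b}) ` B \<Longrightarrow> openin X U" using \<open>B \<subseteq> I\<close> I(4) by blast
    moreover have "B \<subseteq> \<Union>((\<lambda>b. {b}) ` B)" by blast
    ultimately obtain \<F> where "finite \<F>" "\<F> \<subseteq> (\<lambda>b. {b}) ` B" "B \<subseteq> \<Union>\<F>"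
      using compactinD by metis
    moreover from this have "finite (\<Union>\<F>)" by (auto intro!: finite_Union)
    ultimately show False using B(2) finite_subset by blast
  qed
  then obtain x where x: "x \<in> B" "x \<notin> I" by blast
  then obtain y where y: "y \<in> B" "y \<notin> I" "y \<noteq> x"
    using I(5)[rule_format, of B x] B(1) by (auto simp: clopenin_def)
  obtain D where D: "clopenin X D" "x \<in> D" "y \<notin> D"
    using clopen_base_separates[OF I(2,3), of x y] clopen_base_clopenin[OF I(3)]
      x y clopenin_subset[OF B(1)] by auto
  show thesis
  proof
    show "infinite (B \<inter> D)" using inf[of _ x] clopenin_Int[OF B(1) D(1)] x D by blast
    show "infinite (B - D)" using inf[of _ y] clopenin_Diff[OF B(1) D(1)] y D by blast
  qed (rule D(1))
qed

text \<open>\<open>card\<close> is \<open>0\<close> on every infinite set, so the finiteness clause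
  is what keeps the empty set from matching an infinite one. All infinite clopen sets match one
  another.\<close>

definition equinumerous_clopen :: "'a topology \<Rightarrow> 'b topology \<Rightarrow> 'a set \<Rightarrow> 'b set \<Rightarrow> bool" where
  "equinumerous_clopen X Y A B \<longleftrightarrow> clopenin X A \<and> clopenin Y B \<and>
     (finite A \<longleftrightarrow> finite B) \<and> card A = card B"

text \<open>If \<open>A\<close> is infinite, so is \<open>A \<inter> C\<close> or
  \<open>A - C\<close>. Two infinite pieces are copied by \<open>pelczynski_like_split\<close>; a
  finite piece is copied by a finite clopen subset of the same size, whose complement in
  \<open>B\<close> remains infinite.\<close>

lemma equinumerous_clopen_forth:
  assumes Y: "pelczynski_like Y" and AB: "equinumerous_clopen X Y A B" and C: "clopenin X C"
  shows "\<exists>D. equinumerous_clopen X Y (A \<inter> C) (B \<inter> D) \<and> equinumerous_clopen X Y (A - C) (B - D)"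
proof -
  have A: "clopenin X A" and B: "clopenin Y B" and fin: "finite A \<longleftrightarrow> finite B" and card: "card A = card B"
    using AB by (auto simp: equinumerous_clopen_def)
  have AC: "clopenin X (A \<inter> C)" "clopenin X (A - C)"
    using A C clopenin_Int clopenin_Diff by auto
  have Haus: "Hausdorff_space Y" using Y by (simp add: pelczynski_like_def)
  have *: ?thesis if "clopenin Y D" "finite (A \<inter> C) \<longleftrightarrow> finite (B \<inter> D)" "card (A \<inter> C) = card (B \<inter> D)"
      "finite (A - C) \<longleftrightarrow> finite (B - D)" "card (A - C) = card (B - D)" for D
    using that AC B clopenin_Int clopenin_Diff unfolding equinumerous_clopen_def by blast
  consider "finite A" | "infinite (A \<inter> C)" "infinite (A - C)"
    | "infinite A" "finite (A \<inter> C)" | "infinite A" "finite (A - C)" by blast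
  then show ?thesis
  proof cases
    case 1
    then have "card (A \<inter> C) \<le> card B" using card card_mono[OF 1, of "A \<inter> C"] by auto
    then obtain D where D: "D \<subseteq> B" "card D = card (A \<inter> C)" "finite D"
      using obtain_subset_with_card_n by metis
    have "card (A - C) = card (B - D)"
      using card_Diff_subset[OF D(3,1)] card_Diff_subset_Int[of A C] 1 card D(2) by simp
    moreover have "B \<inter> D = D" using D(1) by blast
    ultimately show ?thesis
      using *[of D] clopenin_subset_finite[OF Haus B _ D(1)] 1 fin D by auto
  next
    case 2
    then have "infinite B" using fin by auto
    then obtain D where "clopenin Y D" "infinite (B \<inter> D)" "infinite (B - D)"
      using pelczynski_like_split[OF Y B] by blast
    then show ?thesis using *[of D] 2 by auto
  next
    case 3
    then obtain D where D: "D \<subseteq> B" "clopenin Y D" "finite D" "card D = card (A \<inter> C)"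
      using pelczynski_like_finite_clopen_subset[OF Y B] fin by metis
    moreover have "infinite (A - C)" "infinite (B - D)" "B \<inter> D = D"
      using 3 D fin Diff_infinite_finite[of D B] Diff_infinite_finite[of "A \<inter> C" A]
      by (auto simp: Diff_Int)
    ultimately show ?thesis using *[of D] 3 by auto
  next
    case 4
    \<comment> \<open>Here the finite piece is \<open>A - C\<close>, so \<open>D\<close> copies the
      complement and the witness is \<open>B - D\<close>.\<close>
    then obtain D where D: "D \<subseteq> B" "clopenin Y D" "finite D" "card D = card (A - C)"
      using pelczynski_like_finite_clopen_subset[OF Y B] fin by metis
    have "infinite (A - (A - C))" "infinite (B - D)"
      using 4 D fin Diff_infinite_finite by blast+
    moreover have "B \<inter> (B - D) = B - D" "B - (B - D) = D" "A - (A - C) = A \<inter> C" using D by auto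
    ultimately show ?thesis using *[of "B - D"] clopenin_Diff[OF B D(2)] 4 D by simp
  qed
qed

lemma equinumerous_clopen_conversep:
  "equinumerous_clopen X Y A B \<longleftrightarrow> equinumerous_clopen Y X B A"
  by (auto simp: equinumerous_clopen_def)

text \<open>Adding the empty set makes the family nonempty, as the enumeration by
  \<open>from_nat_into\<close> requires, and keeps it a base.\<close>

lemma countable_clopen_base_range:
  assumes "countable \<A>" "clopen_base X \<A>"
  shows "\<exists>a :: nat \<Rightarrow> _. clopen_base X (range a)"
proof (rule exI)
  have "range (from_nat_into (insert {} \<A>)) = insert {} \<A>"
    using assms(1) by (intro range_from_nat_into) auto
  moreover have "clopen_base X (insert {} \<A>)"
    using assms(2) clopenin_empty[of X] by (simp add: clopen_base_def)
  ultimately show "clopen_base X (range (from_nat_into (insert {} \<A>)))" by simp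
qed

theorem pelczynski_like_homeomorphic_space:
  assumes X: "pelczynski_like X" and Y: "pelczynski_like Y"
  shows "X homeomorphic_space Y"
proof -
  obtain \<A> where a: "countable \<A>" "clopen_base X \<A>"
    by (rule pelczynski_likeE[OF X]) blast
  obtain a :: "nat \<Rightarrow> _" where a': "clopen_base X (range a)"
    using countable_clopen_base_range[OF a] by auto
  obtain \<B> where b: "countable \<B>" "clopen_base Y \<B>"
    by (rule pelczynski_likeE[OF Y]) blast
  obtain b :: "nat \<Rightarrow> _" where b': "clopen_base Y (range b)"
    using countable_clopen_base_range[OF b] by auto
  have "back_and_forth X Y (equinumerous_clopen X Y)"
    unfolding back_and_forth_def
  proof (intro conjI allI impI)
    show "equinumerous_clopen X Y (topspace X) (topspace Y)"
      using pelczynski_like_infinite[OF X] pelczynski_like_infinite[OF Y]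
      by (simp add: equinumerous_clopen_def clopenin_topspace)
  next
    fix A B assume "equinumerous_clopen X Y A B"
    then show "clopenin X A" "clopenin Y B" "A = {} \<longleftrightarrow> B = {}"
      by (auto simp: equinumerous_clopen_def)
  next
    fix A B C assume "equinumerous_clopen X Y A B \<and> clopenin X C"
    then show "\<exists>D. equinumerous_clopen X Y (A \<inter> C) (B \<inter> D) \<and> equinumerous_clopen X Y (A - C) (B - D)"
      using equinumerous_clopen_forth[OF Y] by blast
  next
    fix A B D assume "equinumerous_clopen X Y A B \<and> clopenin Y D"
    then show "\<exists>C. equinumerous_clopen X Y (A \<inter> C) (B \<inter> D) \<and> equinumerous_clopen X Y (A - C) (B - D)"
      using equinumerous_clopen_forth[OF X, of Y B A D] equinumerous_clopen_conversep by metis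
  qed
  moreover have "compact_space X" "Hausdorff_space X" "compact_space Y" "Hausdorff_space Y"
    using X Y by (simp_all add: pelczynski_like_def)
  ultimately show ?thesis
    using back_and_forth_imp_homeomorphic_space[OF _ _ a' _ _ b'] by simp
qed

section \<open>Pelczynski space\<close>

definition cantor_level :: "nat \<Rightarrow> real set" where
  "cantor_level n = (\<Union>(a, b)\<in>cantor_intervals n. {a..b})"

lemma mem_cantor_level:
  "x \<in> cantor_level n \<longleftrightarrow> (\<exists>a b. (a, b) \<in> cantor_intervals n \<and> a \<le> x \<and> x \<le> b)"
  by (force simp: cantor_level_def)

text \<open>A deleted middle third has the same midpoint as the interval it is deleted from;
  \<open>pelczynski_set_eq\<close> makes the link.\<close>

definition cantor_midpoints :: "nat \<Rightarrow> real set" where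
  "cantor_midpoints n = (\<lambda>(a, b). (a + b) / 2) ` cantor_intervals n"

lemma cantor_interval_length: "(a, b) \<in> cantor_intervals n \<Longrightarrow> b = a + 1 / 3 ^ n"
  by (induction n arbitrary: a b) (auto simp: field_simps)

lemma cantor_interval_less: "(a, b) \<in> cantor_intervals n \<Longrightarrow> a < b"
  by (auto dest: cantor_interval_length)

lemma finite_cantor_intervals: "finite (cantor_intervals n)"
  by (induction n) auto

lemma cantor_intervals_SucE:
  assumes "(a, b) \<in> cantor_intervals (Suc n)"
  obtains c d where "(c, d) \<in> cantor_intervals n" "c < d"
    "a = c \<and> b = (2 * c + d) / 3 \<or> a = (c + 2 * d) / 3 \<and> b = d"
  using assms cantor_interval_less by auto

text \<open>Intervals with different parents inherit the gap between the parents; two siblings are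
  separated by the deleted third, which has positive length because \<open>c < d\<close>.\<close>

lemma cantor_intervals_separated:
  assumes "(a, b) \<in> cantor_intervals n" "(a', b') \<in> cantor_intervals n"
  shows "(a, b) = (a', b') \<or> b < a' \<or> b' < a"
  using assms
proof (induction n arbitrary: a b a' b')
  case (Suc n)
  obtain c d where cd: "(c, d) \<in> cantor_intervals n" "c < d"
      "a = c \<and> b = (2 * c + d) / 3 \<or> a = (c + 2 * d) / 3 \<and> b = d"
    using Suc.prems(1) by (rule cantor_intervals_SucE)
  obtain c' d' where cd': "(c', d') \<in> cantor_intervals n" "c' < d'"
      "a' = c' \<and> b' = (2 * c' + d') / 3 \<or> a' = (c' + 2 * d') / 3 \<and> b' = d'"
    using Suc.prems(2) by (rule cantor_intervals_SucE)
  from Suc.IH[OF cd(1) cd'(1)] show ?case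
    using cd(2,3) cd'(2,3) by auto
qed auto

lemma closed_cantor_level: "closed (cantor_level n)"
  unfolding cantor_level_def by (auto intro!: closed_UN finite_cantor_intervals)

lemma cantor_level_Suc: "cantor_level (Suc n) \<subseteq> cantor_level n"
proof
  fix x assume "x \<in> cantor_level (Suc n)"
  then obtain a b where ab: "(a, b) \<in> cantor_intervals (Suc n)" "a \<le> x" "x \<le> b"
    unfolding mem_cantor_level by blast
  from ab(1) obtain c d where cd: "(c, d) \<in> cantor_intervals n" "c < d"
      "a = c \<and> b = (2 * c + d) / 3 \<or> a = (c + 2 * d) / 3 \<and> b = d"
    by (rule cantor_intervals_SucE)
  then have "c \<le> x" "x \<le> d" using ab(2,3) by auto
  with cd(1) show "x \<in> cantor_level n" unfolding mem_cantor_level by blast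
qed

lemma cantor_level_antimono: "n \<le> m \<Longrightarrow> cantor_level m \<subseteq> cantor_level n"
  using lift_Suc_antimono_le[of cantor_level, OF cantor_level_Suc] .

lemma finite_cantor_midpoints: "finite (cantor_midpoints n)"
  by (simp add: cantor_midpoints_def finite_cantor_intervals)

lemma cantor_midpoints_subset_level: "cantor_midpoints n \<subseteq> cantor_level n"
  by (force simp: cantor_midpoints_def cantor_level_def dest: cantor_interval_less)

text \<open>Such a midpoint lies in the third that the next step deletes from its own interval, and
  separation keeps it away from the children of the other intervals.\<close>

lemma cantor_midpoints_disjoint_level: "cantor_midpoints n \<inter> cantor_level (Suc n) = {}"
proof (rule ccontr)
  assume "cantor_midpoints n \<inter> cantor_level (Suc n) \<noteq> {}"
  then obtain x where x: "x \<in> cantor_midpoints n" "x \<in> cantor_level (Suc n)" by blast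
  from x(1) obtain a b where ab: "(a, b) \<in> cantor_intervals n" "x = (a + b) / 2"
    by (auto simp: cantor_midpoints_def)
  from x(2) obtain a' b' where ab': "(a', b') \<in> cantor_intervals (Suc n)" "a' \<le> x" "x \<le> b'"
    unfolding mem_cantor_level by blast
  from ab'(1) obtain c d where cd: "(c, d) \<in> cantor_intervals n" "c < d"
      "a' = c \<and> b' = (2 * c + d) / 3 \<or> a' = (c + 2 * d) / 3 \<and> b' = d"
    by (rule cantor_intervals_SucE)
  have "a < b" using cantor_interval_less[OF ab(1)] .
  then show False
    using cantor_intervals_separated[OF ab(1) cd(1)] ab(2) ab'(2,3) cd(2,3) by auto
qed

lemma cantor_intervals_children:
  assumes "(a, b) \<in> cantor_intervals n"
  shows "(a, (2 * a + b) / 3) \<in> cantor_intervals (Suc n)" "((a + 2 * b) / 3, b) \<in> cantor_intervals (Suc n)"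
  using assms by (auto intro!: bexI[of _ "(a, b)"])

lemma cantor_interval_left: "(a, b) \<in> cantor_intervals n \<Longrightarrow> \<exists>b'. (a, b') \<in> cantor_intervals (n + k)"
  using cantor_intervals_children(1) by (induction k) (auto simp del: cantor_intervals.simps)

lemma cantor_interval_right: "(a, b) \<in> cantor_intervals n \<Longrightarrow> \<exists>a'. (a', b) \<in> cantor_intervals (n + k)"
  using cantor_intervals_children(2) by (induction k) (auto simp del: cantor_intervals.simps)

lemma cantor_set_eq: "cantor_set = (\<Inter>n. cantor_level n)"
  by (simp add: cantor_set_def cantor_level_def)

text \<open>The left child keeps the left endpoint and the right child the right one, so an endpoint
  survives to stage \<open>n + m\<close> for every \<open>m\<close>. Since the levels decrease, it
  then lies in level \<open>m\<close> as well, also when \<open>m < n\<close>.\<close>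

lemma cantor_interval_endpoints:
  assumes "(a, b) \<in> cantor_intervals n" shows "a \<in> cantor_set" "b \<in> cantor_set"
proof -
  have "a \<in> cantor_level m" "b \<in> cantor_level m" for m
  proof -
    obtain a' b' where "(a, b') \<in> cantor_intervals (n + m)" "(a', b) \<in> cantor_intervals (n + m)"
      using cantor_interval_left[OF assms] cantor_interval_right[OF assms] by blast
    then have "a \<in> cantor_level (n + m)" "b \<in> cantor_level (n + m)"
      unfolding mem_cantor_level using cantor_interval_less less_imp_le by blast+
    then show "a \<in> cantor_level m" "b \<in> cantor_level m"
      using cantor_level_antimono[of m "n + m"] by auto
  qed
  then show "a \<in> cantor_set" "b \<in> cantor_set" unfolding cantor_set_eq by blast+
qed

lemma pelczynski_set_eq: "pelczynski_set = cantor_set \<union> (\<Union>n. cantor_midpoints n)"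
proof -
  have "(\<lambda>(c, d). midpoint c d) ` (\<Union>(a, b)\<in>I. {((2 * a + b) / 3, (a + 2 * b) / 3)})
    = (\<lambda>(a, b). (a + b) / 2) ` I" for I :: "(real \<times> real) set"
    by (force simp: midpoint_def field_simps image_iff)
  then show ?thesis
    by (simp add: pelczynski_set_def deleted_intervals_def cantor_midpoints_def image_UN)
qed

text \<open>A midpoint of stage \<open>k \<ge> n\<close> still lies in level \<open>n\<close>. So
  outside that level only finitely many points remain, which makes these approximations
  closed.\<close>

lemma pelczynski_set_subset:
  "pelczynski_set \<subseteq> cantor_level n \<union> (\<Union>k<n. cantor_midpoints k)"
proof -
  have "cantor_midpoints k \<subseteq> cantor_level n \<union> (\<Union>k<n. cantor_midpoints k)" for k
  proof (cases "k < n")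
    case False
    then have "cantor_midpoints k \<subseteq> cantor_level n"
      using cantor_midpoints_subset_level[of k] cantor_level_antimono[of n k] by auto
    then show ?thesis by blast
  qed blast
  moreover have "cantor_set \<subseteq> cantor_level n" unfolding cantor_set_eq by blast
  ultimately show ?thesis unfolding pelczynski_set_eq by (simp add: UN_subset_iff le_supI1)
qed

lemma finite_midpoints_below: "finite (\<Union>k<n. cantor_midpoints k)"
  by (simp add: finite_cantor_midpoints)

text \<open>The set is the intersection of its closed approximations: a point of all of them that
  misses some level is a midpoint of an earlier stage.\<close>

lemma compact_pelczynski_set: "compact pelczynski_set"
proof -
  have "(\<Inter>n. cantor_level n \<union> (\<Union>k<n. cantor_midpoints k)) \<subseteq> pelczynski_set"
    unfolding pelczynski_set_eq cantor_set_eq by blast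
  then have eq: "pelczynski_set = (\<Inter>n. cantor_level n \<union> (\<Union>k<n. cantor_midpoints k))"
    using pelczynski_set_subset by blast
  have "closed pelczynski_set"
    unfolding eq by (intro closed_INT ballI closed_Un closed_cantor_level finite_imp_closed finite_midpoints_below)
  moreover have "pelczynski_set \<subseteq> {0..1}"
    using pelczynski_set_subset[of 0] by (simp add: cantor_level_def)
  ultimately show ?thesis
    using bounded_subset[OF bounded_closed_interval] compact_eq_bounded_closed by metis
qed

lemma clopenin_pelczynskiI:
  assumes "closed A" "closed K" "pelczynski_set \<subseteq> A \<union> K" "A \<inter> K = {}"
  shows "clopenin pelczynski_space (pelczynski_set \<inter> A)"
proof -
  have "pelczynski_set \<inter> A = pelczynski_set \<inter> (- K)" using assms(3,4) by blast
  then show ?thesis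
    using assms(1,2) openin_open_Int[of "- K" pelczynski_set] closedin_closed_Int[of A pelczynski_set]
    by (auto simp: clopenin_def open_Compl)
qed

lemma clopenin_cantor_interval:
  assumes ab: "(a, b) \<in> cantor_intervals n"
  shows "clopenin pelczynski_space (pelczynski_set \<inter> {a..b})"
proof (rule clopenin_pelczynskiI)
  \<comment> \<open>The closed complement consists of the other intervals of stage \<open>n\<close>
    and a finite set of earlier midpoints; subtracting \<open>{a..b}\<close> from the latter makes
    disjointness immediate.\<close>
  let ?K = "(\<Union>(a', b')\<in>cantor_intervals n - {(a, b)}. {a'..b'}) \<union> ((\<Union>k<n. cantor_midpoints k) - {a..b})"
  show "closed ?K"
    by (intro closed_Un closed_UN finite_imp_closed finite_Diff finite_midpoints_below finite_cantor_intervals)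
      (auto simp: closed_atLeastAtMost)
  show "pelczynski_set \<subseteq> {a..b} \<union> ?K"
    using pelczynski_set_subset[of n] unfolding cantor_level_def by blast
  show "{a..b} \<inter> ?K = {}"
    using cantor_intervals_separated[OF ab] by fastforce
qed simp

lemma clopenin_cantor_midpoint:
  assumes d: "d \<in> cantor_midpoints n"
  shows "clopenin pelczynski_space {d}"
proof -
  let ?K = "cantor_level (Suc n) \<union> ((\<Union>k<Suc n. cantor_midpoints k) - {d})"
  have "clopenin pelczynski_space (pelczynski_set \<inter> {d})"
  proof (rule clopenin_pelczynskiI)
    show "closed ?K"
      by (intro closed_Un closed_cantor_level finite_imp_closed finite_Diff finite_midpoints_below)
    show "pelczynski_set \<subseteq> {d} \<union> ?K"
      using pelczynski_set_subset[of "Suc n"] by blast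
    show "{d} \<inter> ?K = {}"
      using d cantor_midpoints_disjoint_level[of n] by blast
  qed simp
  moreover have "d \<in> pelczynski_set" using d by (auto simp: pelczynski_set_eq)
  ultimately show ?thesis by (simp add: Int_absorb1)
qed

lemma cantor_set_nhd_interval:
  assumes U: "openin pelczynski_space U" and x: "x \<in> U" "x \<in> cantor_set"
  obtains a b n where "(a, b) \<in> cantor_intervals n" "x \<in> {a..b}" "pelczynski_set \<inter> {a..b} \<subseteq> U"
proof -
  obtain V where V: "open V" "U = pelczynski_set \<inter> V" using U by (auto simp: openin_open)
  then obtain e where e: "e > 0" "\<And>y. dist y x < e \<Longrightarrow> y \<in> V"
    using x(1) by (auto simp: open_dist)
  obtain n where n: "(1 / 3) ^ n < e" using real_arch_pow_inv[OF e(1), of "1 / 3"] by auto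
  obtain a b where ab: "(a, b) \<in> cantor_intervals n" "x \<in> {a..b}"
    using x(2) mem_cantor_level[of x n] unfolding cantor_set_eq by auto
  have "dist y x < e" if "y \<in> {a..b}" for y
    using that ab(2) n cantor_interval_length[OF ab(1)] by (auto simp: dist_real_def power_one_over)
  then have "pelczynski_set \<inter> {a..b} \<subseteq> U" using e(2) V(2) by blast
  with ab show thesis by (rule that)
qed

text \<open>The midpoints serve as the isolated points and the Cantor set as the perfect part. Every
  neighbourhood of a Cantor point contains the trace of a Cantor interval around it, and with it the
  midpoint and both endpoints of that interval.\<close>

lemma pelczynski_like_pelczynski_space: "pelczynski_like pelczynski_space"
proof -
  let ?I = "\<lambda>(a, b). pelczynski_set \<inter> {a..b}"
  let ?D = "\<Union>n. cantor_midpoints n"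
  let ?A = "(\<Union>n. ?I ` cantor_intervals n) \<union> (\<lambda>d. {d}) ` ?D"
  have D: "cantor_set \<inter> ?D = {}"
    using cantor_midpoints_disjoint_level unfolding cantor_set_eq by blast
  have P: "x \<in> cantor_set \<or> x \<in> ?D" if "openin pelczynski_space U" "x \<in> U" for U x
    using openin_subset[OF that(1)] that(2) by (auto simp: pelczynski_set_eq)
  have "countable ?A"
    by (intro countable_Un countable_UN countable_image)
      (auto intro!: countable_finite finite_cantor_intervals finite_cantor_midpoints)
  have "clopen_base pelczynski_space ?A"
    unfolding clopen_base_def
  proof (intro conjI ballI allI impI)
    fix A assume "A \<in> ?A"
    then show "clopenin pelczynski_space A"
      using clopenin_cantor_interval clopenin_cantor_midpoint by auto
  next
    fix U x assume *: "openin pelczynski_space U \<and> x \<in> U"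
    then consider "x \<in> cantor_set" | "x \<in> ?D" using P by blast
    then show "\<exists>A\<in>?A. x \<in> A \<and> A \<subseteq> U"
    proof cases
      case 1
      obtain a b n where ab: "(a, b) \<in> cantor_intervals n" "x \<in> {a..b}" "pelczynski_set \<inter> {a..b} \<subseteq> U"
        by (rule cantor_set_nhd_interval[of U x]) (use * 1 in simp_all)
      show ?thesis
      proof (intro bexI conjI)
        show "x \<in> ?I (a, b)" using ab(2) 1 by (simp add: pelczynski_set_eq)
        show "?I (a, b) \<subseteq> U" using ab(3) by simp
        show "?I (a, b) \<in> ?A" using ab(1) by blast
      qed
    next
      case 2
      then show ?thesis using * by (intro bexI[of _ "{x}"]) auto
    qed
  qed
  have "topspace pelczynski_space - ?D \<noteq> {}"
  proof -
    have "0 \<in> cantor_set" using cantor_interval_endpoints(1)[of 0 1 0] by simp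
    then show ?thesis using D by (auto simp: pelczynski_set_eq)
  qed
  have "\<forall>d\<in>?D. openin pelczynski_space {d}"
    using clopenin_cantor_midpoint by (auto simp: clopenin_def)
  have "\<forall>U. openin pelczynski_space U \<and> U \<noteq> {} \<longrightarrow> U \<inter> ?D \<noteq> {}"
  proof (intro allI impI)
    fix U assume "openin pelczynski_space U \<and> U \<noteq> {}"
    then have U: "openin pelczynski_space U" "U \<noteq> {}" by auto
    obtain x where "x \<in> U" using U by blast
    then consider "x \<in> cantor_set" | "x \<in> ?D" using P U by blast
    then show "U \<inter> ?D \<noteq> {}"
    proof cases
      case 1
      obtain a b n where ab: "(a, b) \<in> cantor_intervals n" "pelczynski_set \<inter> {a..b} \<subseteq> U"
        by (rule cantor_set_nhd_interval[OF U(1) \<open>x \<in> U\<close> 1])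
      have "(a + b) / 2 \<in> {a..b}" using cantor_interval_less[OF ab(1)] by auto
      moreover have "(a + b) / 2 \<in> ?D" using ab(1) by (force simp: cantor_midpoints_def)
      ultimately show ?thesis using ab(2) unfolding pelczynski_set_eq by blast
    qed (use \<open>x \<in> U\<close> in blast)
  qed
  have "\<forall>U x. openin pelczynski_space U \<and> x \<in> U - ?D \<longrightarrow> (\<exists>y\<in>U - ?D. y \<noteq> x)"
  proof (intro allI impI)
    fix U x assume "openin pelczynski_space U \<and> x \<in> U - ?D"
    then have U: "openin pelczynski_space U" "x \<in> U - ?D" by auto
    have x: "x \<in> U" "x \<in> cantor_set" using P[of U x] U by simp_all
    obtain a b n where ab: "(a, b) \<in> cantor_intervals n" "pelczynski_set \<inter> {a..b} \<subseteq> U"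
      by (rule cantor_set_nhd_interval[OF U(1) x])
    have less: "a < b" using cantor_interval_less[OF ab(1)] .
    \<comment> \<open>Both endpoints are Cantor points inside \<open>U\<close>, and \<open>x\<close>
      can coincide with at most one of them.\<close>
    have "a \<in> U" "b \<in> U"
      using cantor_interval_endpoints[OF ab(1)] less subsetD[OF ab(2)]
      by (simp_all add: pelczynski_set_eq)
    moreover have "a \<notin> ?D" "b \<notin> ?D"
      using cantor_interval_endpoints[OF ab(1)] D by blast+
    ultimately have "a \<in> U - ?D" "b \<in> U - ?D" by simp_all
    then show "\<exists>y\<in>U - ?D. y \<noteq> x"
      using less bexI[of "\<lambda>y. y \<noteq> x" a "U - ?D"] bexI[of "\<lambda>y. y \<noteq> x" b "U - ?D"] by linarith
  qed
  have "compact_space pelczynski_space"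
    using compact_pelczynski_set by (simp add: compact_space_subtopology)
  have "Hausdorff_space pelczynski_space"
    by (simp add: Hausdorff_space_subtopology)
  show ?thesis
    unfolding pelczynski_like_def by (intro conjI exI[of _ ?A] exI[of _ ?D]; fact)
qed

section \<open>Finite \<open>p\<close>-groups\<close>

text \<open>The length of an orbit divides \<open>p ^ k\<close>, so it is a power of
  \<open>p\<close>, and exponent \<open>0\<close> means a fixed point.\<close>

lemma (in group_action) orbit_dvd_or_fixed:
  assumes p: "prime p" and ord: "order G = p ^ k" and y: "y \<in> E"
  shows "p dvd card (orbit G \<phi> y) \<or> (\<forall>g\<in>carrier G. \<phi> g y = y)"
proof (cases "p dvd card (orbit G \<phi> y)")
  case False
  have "card (orbit G \<phi> y) dvd p ^ k"
    using orbit_stabilizer_theorem[OF y] ord by (metis dvd_triv_left)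
  then obtain j where "card (orbit G \<phi> y) = p ^ j"
    using p by (auto simp: divides_primepow_nat)
  with False have "card (orbit G \<phi> y) = 1" by (cases j) auto
  then obtain z where z: "orbit G \<phi> y = {z}" by (auto simp: card_1_singleton_iff)
  then have "z = y" using orbit_refl[OF y] by simp
  moreover have "\<phi> g y \<in> orbit G \<phi> y" if "g \<in> carrier G" for g
    using that by (auto simp: orbit_def)
  ultimately show ?thesis using z by auto
qed simp

text \<open>Class equation: if \<open>x\<close> were the only fixed point in \<open>S\<close>, the
  remaining orbits would have lengths divisible by \<open>p\<close>, and \<open>p\<close> would
  divide both \<open>card S\<close> and \<open>card S - 1\<close>.\<close>

lemma (in group_action) another_fixed_point:
  assumes p: "prime p" and ord: "order G = p ^ k"
    and S: "finite S" "S \<subseteq> E" "\<And>g s. g \<in> carrier G \<Longrightarrow> s \<in> S \<Longrightarrow> \<phi> g s \<in> S" "p dvd card S"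
    and x: "x \<in> S" "\<And>g. g \<in> carrier G \<Longrightarrow> \<phi> g x = x"
  obtains y where "y \<in> S" "y \<noteq> x" "\<And>g. g \<in> carrier G \<Longrightarrow> \<phi> g y = y"
proof -
  let ?C = "orbit G \<phi> ` (S - {x})"
  have orb: "orbit G \<phi> y \<subseteq> S - {x}" if y: "y \<in> S - {x}" for y
  proof
    fix z assume z: "z \<in> orbit G \<phi> y"
    then have "z \<in> S" using S(3) y by (auto simp: orbit_def)
    moreover have "z \<noteq> x"
    proof
      assume "z = x"
      then have "y \<in> orbit G \<phi> x" using orbit_sym z y x(1) S(2) by blast
      then show False using x(2) y by (auto simp: orbit_def)
    qed
    ultimately show "z \<in> S - {x}" by simp
  qed
  have Un: "\<Union>?C = S - {x}" using orb orbit_refl S(2) by blast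
  have dis: "\<forall>c1\<in>?C. \<forall>c2\<in>?C. c1 \<noteq> c2 \<longrightarrow> c1 \<inter> c2 = {}"
    using disjoint_union S(2) unfolding orbits_def by blast
  have "\<exists>y\<in>S - {x}. \<forall>g\<in>carrier G. \<phi> g y = y"
  proof (rule ccontr)
    assume "\<not> ?thesis"
    then have "p dvd card (orbit G \<phi> y)" if "y \<in> S - {x}" for y
      using orbit_dvd_or_fixed[OF p ord, of y] that S(2) by blast
    then have "p dvd card (\<Union>?C)"
      using dis S(1) Un by (intro dvd_partition) auto
    then have "p dvd card S - 1" using Un S(1) x(1) by simp
    moreover have "card S = (card S - 1) + 1" using S(1) x(1) by (metis Suc_eq_plus1 card_Suc_Diff1 card_Diff_singleton)
    ultimately have "p dvd 1" using S(4) by (metis dvd_add_right_iff)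
    then show False using p by simp
  qed
  then show thesis using that by blast
qed

text \<open>The orbit of \<open>x\<close> has length divisible by \<open>p\<close>, because
  \<open>L\<close> is proper. Restricting the action to \<open>L\<close>, the fixed point
  \<open>x\<close> is accompanied by another one, \<open>\<phi> g x\<close>; that \<open>L\<close>
  fixes it means that \<open>inv g \<otimes> l \<otimes> g\<close> fixes \<open>x\<close>.\<close>

lemma (in group_action) p_group_stabilizer_normalized:
  assumes p: "prime p" and ord: "order G = p ^ k"
    and x: "x \<in> E" and L: "L = stabilizer G \<phi> x" "L \<noteq> carrier G"
  obtains g where "g \<in> carrier G - L" "\<And>l. l \<in> L \<Longrightarrow> inv g \<otimes> l \<otimes> g \<in> L"
proof -
  interpret G: group G by (rule group_hom.axioms(1)[OF group_hom])
  have fin: "finite (carrier G)" using ord p G.order_gt_0_iff_finite prime_gt_0_nat by fastforce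
  have sub: "subgroup L G" using stabilizer_subgroup[OF x] L(1) by simp
  have "finite L" using fin subgroup.subset[OF sub] finite_subset by blast
  then have card_pos: "card L > 0" using subgroup.one_closed[OF sub] card_gt_0_iff by blast
  have mul: "card (orbit G \<phi> x) * card L = p ^ k"
    using orbit_stabilizer_theorem[OF x] ord L(1) by simp
  have "\<exists>j. card L = p ^ j"
    using mul p by (metis divides_primepow_nat dvd_triv_right)
  then obtain j where j: "card L = p ^ j" by blast
  have "p dvd card (orbit G \<phi> x)"
  proof (rule ccontr)
    assume "\<not> ?thesis"
    then have "\<forall>g\<in>carrier G. \<phi> g x = x" using orbit_dvd_or_fixed[OF p ord x] by blast
    then show False using L unfolding stabilizer_def by blast
  qed
  interpret L: group_action "G\<lparr>carrier := L\<rparr>" E \<phi> by (rule induced_action[OF sub])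
  have orb: "\<phi> g s \<in> orbit G \<phi> x" if gs: "g \<in> carrier G" "s \<in> orbit G \<phi> x" for g s
  proof -
    obtain h where h: "h \<in> carrier G" "s = \<phi> h x" using gs(2) by (auto simp: orbit_def)
    then have "\<phi> g s = \<phi> (g \<otimes> h) x" using composition_rule[OF x gs(1) h(1)] by simp
    then show ?thesis using G.m_closed[OF gs(1) h(1)] unfolding orbit_def by blast
  qed
  obtain y where y: "y \<in> orbit G \<phi> x" "y \<noteq> x" "\<And>g. g \<in> L \<Longrightarrow> \<phi> g y = y"
  proof (rule L.another_fixed_point[OF p, of j "orbit G \<phi> x" x])
    show "order (G\<lparr>carrier := L\<rparr>) = p ^ j" using j by (simp add: order_def)
    show "finite (orbit G \<phi> x)" using fin by (auto simp: orbit_def)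
    show "orbit G \<phi> x \<subseteq> E" using element_image[OF _ x] by (auto simp: orbit_def)
    show "\<phi> g s \<in> orbit G \<phi> x" if "g \<in> carrier (G\<lparr>carrier := L\<rparr>)" "s \<in> orbit G \<phi> x" for g s
      by (rule orb) (use that subgroup.mem_carrier[OF sub] in simp_all)
    show "p dvd card (orbit G \<phi> x)" by fact
    show "x \<in> orbit G \<phi> x" by (rule orbit_refl[OF x])
    show "\<phi> g x = x" if "g \<in> carrier (G\<lparr>carrier := L\<rparr>)" for g
      using that L(1) by (simp add: stabilizer_def)
  qed simp
  obtain g where g: "g \<in> carrier G" "y = \<phi> g x" using y(1) by (auto simp: orbit_def)
  show thesis
  proof
    show "g \<in> carrier G - L" using g y(2) L(1) by (auto simp: stabilizer_def)
    fix l assume l: "l \<in> L"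
    then have lG: "l \<in> carrier G" using subgroup.mem_carrier[OF sub] by blast
    have "\<phi> (l \<otimes> g) x = \<phi> g x"
      using composition_rule[OF x lG g(1)] y(3)[OF l] g(2) by simp
    then have "\<phi> (inv g \<otimes> (l \<otimes> g)) x = \<phi> (inv g) (\<phi> g x)"
      using composition_rule[OF x G.inv_closed[OF g(1)] G.m_closed[OF lG g(1)]] by simp
    also have "\<dots> = x" using orbit_sym_aux[OF g(1) x] by simp
    finally show "inv g \<otimes> l \<otimes> g \<in> L"
      using L(1) lG g(1) by (simp add: stabilizer_def G.m_assoc)
  qed
qed

text \<open>Conjugation is injective, and an injective self-map of a finite set is onto, so one
  inclusion suffices.\<close>

lemma (in group) conjugation_eqI:
  assumes "subgroup L G" "finite L" "g \<in> carrier G" "\<And>l. l \<in> L \<Longrightarrow> g \<otimes> l \<otimes> inv g \<in> L"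
  shows "g <# L #> inv g = L"
proof -
  have "inj_on (\<lambda>l. g \<otimes> l \<otimes> inv g) L"
    using assms(3) subgroup.mem_carrier[OF assms(1)]
    by (auto intro!: inj_onI)
  moreover have "(\<lambda>l. g \<otimes> l \<otimes> inv g) ` L \<subseteq> L" using assms(4) by blast
  ultimately have "(\<lambda>l. g \<otimes> l \<otimes> inv g) ` L = L" using assms(2) by (meson endo_inj_surj)
  moreover have "g <# L #> inv g = (\<lambda>l. g \<otimes> l \<otimes> inv g) ` L"
    by (auto simp: l_coset_def r_coset_def)
  ultimately show ?thesis by simp
qed

lemma (in group) finite_subgroup_subset_normalizer:
  assumes L: "subgroup L G" "finite L" shows "L \<subseteq> normalizer G L"
proof
  fix l assume l: "l \<in> L"
  then have lG: "l \<in> carrier G" by (rule subgroup.mem_carrier[OF L(1)])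
  have "l <# L #> inv l = L"
  proof (rule conjugation_eqI[OF L lG])
    show "l \<otimes> h \<otimes> inv l \<in> L" if h: "h \<in> L" for h
      by (rule subgroup.m_closed[OF L(1) subgroup.m_closed[OF L(1) l h] subgroup.m_inv_closed[OF L(1) l]])
  qed
  then show "l \<in> normalizer G L"
    using lG subgroup.subset[OF L(1)] by (auto simp: normalizer_def stabilizer_def)
qed

text \<open>If \<open>L\<close> were its own normaliser, it would be the stabiliser of the point
  \<open>L\<close> for conjugation on subsets, and \<open>p_group_stabilizer_normalized\<close>
  would give an element outside \<open>L\<close> that normalises \<open>L\<close>.\<close>

lemma (in group) p_group_normalizer_grows:
  assumes p: "prime p" and ord: "order G = p ^ k" and L: "subgroup L G" "L \<noteq> carrier G"
  obtains g where "g \<in> carrier G - L" "g \<in> normalizer G L"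
proof -
  have LG: "L \<subseteq> carrier G" using L(1) subgroup.subset by blast
  have fin: "finite (carrier G)" using ord p order_gt_0_iff_finite prime_gt_0_nat by fastforce
  have "finite L" using fin LG finite_subset by blast
  let ?\<phi> = "\<lambda>g. \<lambda>H\<in>{H. H \<subseteq> carrier G}. g <# H #> (inv g)"
  interpret A: group_action G "{H. H \<subseteq> carrier G}" ?\<phi>
    by (rule action_by_conjugation_on_power_set)
  have L_norm: "L \<subseteq> normalizer G L"
    by (rule finite_subgroup_subset_normalizer[OF L(1) \<open>finite L\<close>])
  show thesis
  proof (cases "L = normalizer G L")
    case True
    then have st: "L = stabilizer G ?\<phi> L" by (simp add: normalizer_def)
    obtain g where g: "g \<in> carrier G - L" "\<And>l. l \<in> L \<Longrightarrow> inv g \<otimes> l \<otimes> g \<in> L"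
      using A.p_group_stabilizer_normalized[OF p ord _ st L(2)] LG by blast
    \<comment> \<open>The element obtained conjugates by \<open>inv g\<close> on the left, so it is
      \<open>inv g\<close> that is seen to normalise \<open>L\<close>.\<close>
    then have "inv g <# L #> inv (inv g) = L"
      using L(1) \<open>finite L\<close> by (intro conjugation_eqI) auto
    then have "inv g \<in> normalizer G L" using g(1) LG by (auto simp: normalizer_def stabilizer_def)
    then have "inv g \<in> L" using True by simp
    then have "inv (inv g) \<in> L" by (rule subgroup.m_inv_closed[OF L(1)])
    then show thesis using g(1) by simp
  next
    case False
    then obtain g where "g \<in> normalizer G L" "g \<notin> L" using L_norm by blast
    then show thesis
      using that[of g] subgroup.mem_carrier[OF normalizer_imp_subgroup[OF LG]] by simp
  qed
qed

lemma (in group) normalizer_eq_carrier_imp_normal: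
  assumes "subgroup L G" "normalizer G L = carrier G" shows "L \<lhd> G"
proof (rule normal_invI[OF assms(1)])
  fix x h assume xh: "x \<in> carrier G" "h \<in> L"
  have "x <# L #> inv x = L"
    using assms subgroup.subset[OF assms(1)] xh(1) by (auto simp: normalizer_def stabilizer_def)
  moreover have "x \<otimes> h \<otimes> inv x \<in> x <# L #> inv x"
    using xh(2) by (auto simp: l_coset_def r_coset_def)
  ultimately show "x \<otimes> h \<otimes> inv x \<in> L" by simp
qed

text \<open>Maximality will concern subgroups of \<open>G\<close>, so the centraliser of an element
  of the quotient is pulled back along the projection.\<close>

lemma (in group_hom) centralizer_preimage_subgroup:
  assumes a: "a \<in> carrier H"
  shows "subgroup {z \<in> carrier G. a \<otimes>\<^bsub>H\<^esub> h z = h z \<otimes>\<^bsub>H\<^esub> a} G"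
proof (rule G.subgroupI)
  show "{z \<in> carrier G. a \<otimes>\<^bsub>H\<^esub> h z = h z \<otimes>\<^bsub>H\<^esub> a} \<noteq> {}" using a by force
next
  fix z assume z: "z \<in> {z \<in> carrier G. a \<otimes>\<^bsub>H\<^esub> h z = h z \<otimes>\<^bsub>H\<^esub> a}"
  then have c: "h z \<in> carrier H" by simp
  have "a \<otimes>\<^bsub>H\<^esub> inv\<^bsub>H\<^esub> (h z) = inv\<^bsub>H\<^esub> (h z) \<otimes>\<^bsub>H\<^esub> (h z \<otimes>\<^bsub>H\<^esub> a) \<otimes>\<^bsub>H\<^esub> inv\<^bsub>H\<^esub> (h z)"
    using a c by (simp add: H.inv_solve_left' H.m_assoc[symmetric])
  also have "\<dots> = inv\<^bsub>H\<^esub> (h z) \<otimes>\<^bsub>H\<^esub> (a \<otimes>\<^bsub>H\<^esub> h z) \<otimes>\<^bsub>H\<^esub> inv\<^bsub>H\<^esub> (h z)"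
    using z by simp
  also have "\<dots> = inv\<^bsub>H\<^esub> (h z) \<otimes>\<^bsub>H\<^esub> a"
    using a c by (simp add: H.m_assoc)
  finally show "inv z \<in> {z \<in> carrier G. a \<otimes>\<^bsub>H\<^esub> h z = h z \<otimes>\<^bsub>H\<^esub> a}"
    using z by simp
next
  fix y z assume y: "y \<in> {z \<in> carrier G. a \<otimes>\<^bsub>H\<^esub> h z = h z \<otimes>\<^bsub>H\<^esub> a}"
    and z: "z \<in> {z \<in> carrier G. a \<otimes>\<^bsub>H\<^esub> h z = h z \<otimes>\<^bsub>H\<^esub> a}"
  have c: "h y \<in> carrier H" "h z \<in> carrier H" using y z by auto
  have "a \<otimes>\<^bsub>H\<^esub> (h y \<otimes>\<^bsub>H\<^esub> h z) = (a \<otimes>\<^bsub>H\<^esub> h y) \<otimes>\<^bsub>H\<^esub> h z"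
    using a c by (simp only: H.m_assoc)
  also have "\<dots> = (h y \<otimes>\<^bsub>H\<^esub> a) \<otimes>\<^bsub>H\<^esub> h z" using y by simp
  also have "\<dots> = h y \<otimes>\<^bsub>H\<^esub> (a \<otimes>\<^bsub>H\<^esub> h z)" using a c by (simp only: H.m_assoc)
  also have "\<dots> = h y \<otimes>\<^bsub>H\<^esub> (h z \<otimes>\<^bsub>H\<^esub> a)" using z by simp
  also have "\<dots> = (h y \<otimes>\<^bsub>H\<^esub> h z) \<otimes>\<^bsub>H\<^esub> a" using a c by (simp only: H.m_assoc)
  finally show "y \<otimes> z \<in> {z \<in> carrier G. a \<otimes>\<^bsub>H\<^esub> h z = h z \<otimes>\<^bsub>H\<^esub> a}"
    using y z by simp
qed auto

lemma (in normal) group_hom_rcoset: "group_hom G (G Mod H) (\<lambda>x. H #> x)"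
  by (intro group_hom.intro group_hom_axioms.intro is_group factorgroup_is_group r_coset_hom_Mod)

text \<open>For \<open>x\<close> outside \<open>M\<close>, the elements that commute with
  \<open>x\<close> modulo \<open>M\<close> form a subgroup containing \<open>M\<close> and
  \<open>x\<close>, hence all of \<open>G\<close> by maximality. So the quotient is commutative,
  with no appeal to its order.\<close>

lemma (in group) maximal_normal_derived_subset:
  assumes M: "M \<lhd> G" and max: "\<And>K. subgroup K G \<Longrightarrow> M \<subset> K \<Longrightarrow> K = carrier G"
  shows "derived G (carrier G) \<subseteq> M"
proof (rule derived_minimal[OF M])
  interpret M: normal M G by (rule M)
  interpret h: group_hom G "G Mod M" "\<lambda>x. M #> x" by (rule M.group_hom_rcoset)
  have one: "M #> z = \<one>\<^bsub>G Mod M\<^esub>" if "z \<in> M" for z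
    using that M.subset coset_join2[OF _ M.subgroup_axioms] by (auto simp: FactGroup_def)
  show "comm_group (G Mod M)"
  proof (rule h.H.group_comm_groupI)
    fix A B assume A: "A \<in> carrier (G Mod M)" and B: "B \<in> carrier (G Mod M)"
    obtain x where x: "x \<in> carrier G" "A = M #> x" using A by (auto simp: carrier_FactGroup)
    obtain y where y: "y \<in> carrier G" "B = M #> y" using B by (auto simp: carrier_FactGroup)
    let ?K = "{z \<in> carrier G. A \<otimes>\<^bsub>G Mod M\<^esub> (M #> z) = (M #> z) \<otimes>\<^bsub>G Mod M\<^esub> A}"
    show "A \<otimes>\<^bsub>G Mod M\<^esub> B = B \<otimes>\<^bsub>G Mod M\<^esub> A"
    proof (cases "x \<in> M")
      case True
      then show ?thesis using one x(2) h.H.r_one[OF B] h.H.l_one[OF B] by metis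
    next
      case False
      have "z \<in> ?K" if "z \<in> M" for z
        using one[OF that] that M.subset h.H.r_one[OF A] h.H.l_one[OF A] by auto
      moreover have "x \<in> ?K" using x by simp
      ultimately have "M \<subset> ?K" using False by blast
      then have "?K = carrier G" by (rule max[OF h.centralizer_preimage_subgroup[OF A]])
      then show ?thesis using y by blast
    qed
  qed
qed

text \<open>A proper \<open>L\<close> lies in a maximal proper subgroup \<open>M\<close>. Growth of
  normalisers makes \<open>M\<close> normal, so it contains the derived subgroup, and the product
  stays inside \<open>M\<close>.\<close>

lemma (in group) p_group_supplement_derived:
  assumes p: "prime p" and ord: "order G = p ^ k" and L: "subgroup L G"
    and eq: "L <#> derived G (carrier G) = carrier G"
  shows "L = carrier G"
proof (rule ccontr)
  assume ne: "L \<noteq> carrier G"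
  have fin: "finite (carrier G)" using ord p order_gt_0_iff_finite prime_gt_0_nat by fastforce
  let ?S = "{M. subgroup M G \<and> L \<subseteq> M \<and> M \<noteq> carrier G}"
  have "finite ?S" using fin by (auto intro!: finite_subset[of ?S "Pow (carrier G)"] dest: subgroup.subset)
  moreover have "L \<in> ?S" using L ne by simp
  ultimately have "\<exists>M\<in>?S. \<forall>K\<in>?S. M \<subseteq> K \<longrightarrow> M = K"
    by (intro finite_has_maximal) auto
  then obtain M where M: "M \<in> ?S" "\<forall>K\<in>?S. M \<subseteq> K \<longrightarrow> M = K"
    by (rule bexE)
  have max: "K = carrier G" if "subgroup K G" "M \<subset> K" for K
    using M that by blast
  have sub: "subgroup M G" "M \<noteq> carrier G" using M by auto
  obtain g where g: "g \<in> carrier G - M" "g \<in> normalizer G M"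
    by (rule p_group_normalizer_grows[OF p ord sub])
  have MG: "M \<subseteq> carrier G" using sub subgroup.subset by blast
  have "M \<subseteq> normalizer G M"
    by (rule finite_subgroup_subset_normalizer[OF sub(1) finite_subset[OF MG fin]])
  then have "normalizer G M = carrier G"
    using g normalizer_imp_subgroup[OF MG] by (intro max) auto
  then have "M \<lhd> G" by (rule normalizer_eq_carrier_imp_normal[OF sub(1)])
  then have "derived G (carrier G) \<subseteq> M" using max by (rule maximal_normal_derived_subset)
  moreover have "L \<subseteq> M" using M by blast
  ultimately have "L <#> derived G (carrier G) \<subseteq> M"
    using subgroup.m_closed[OF sub(1)] by (auto simp: set_mult_def)
  then show False using eq MG sub(2) by blast
qed

text \<open>The order of \<open>N\<close> is again a power of \<open>p\<close>, and the derived
  subgroup taken inside \<open>N\<close> agrees with the one taken in \<open>G\<close>.\<close>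

lemma (in group) p_group_supplement_derived_subgroup:
  assumes p: "prime p" and ord: "order G = p ^ k" and N: "subgroup N G" and L: "subgroup L G" "L \<subseteq> N"
    and eq: "L <#> derived G N = N"
  shows "L = N"
proof -
  interpret N: group "G\<lparr>carrier := N\<rparr>" by (rule subgroup_imp_group[OF N])
  have "card N dvd p ^ k" using lagrange[OF N] ord by (metis dvd_triv_right)
  then obtain j where j: "order (G\<lparr>carrier := N\<rparr>) = p ^ j"
    using p by (auto simp: divides_primepow_nat order_def)
  have "L = carrier (G\<lparr>carrier := N\<rparr>)"
    by (rule N.p_group_supplement_derived[OF p j])
      (use eq L N subgroup_incl in \<open>simp_all add: derived_consistent\<close>)
  then show ?thesis by simp
qed

section \<open>Profinite groups\<close>

text \<open>This is the intersection of all conjugates of \<open>H\<close>, written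
  elementwise.\<close>

definition (in group) normal_core :: "'a set \<Rightarrow> 'a set" where
  "normal_core H = {x \<in> carrier G. \<forall>g\<in>carrier G. g \<otimes> x \<otimes> inv g \<in> H}"

lemma (in group) normal_core_subset: "H \<subseteq> carrier G \<Longrightarrow> normal_core H \<subseteq> H"
  by (force simp: normal_core_def dest: bspec[where x = \<one>])

lemma (in group) conj_mult:
  assumes "g \<in> carrier G" "x \<in> carrier G" "y \<in> carrier G"
  shows "g \<otimes> (x \<otimes> y) \<otimes> inv g = (g \<otimes> x \<otimes> inv g) \<otimes> (g \<otimes> y \<otimes> inv g)"
proof -
  have "(g \<otimes> x \<otimes> inv g) \<otimes> (g \<otimes> y \<otimes> inv g) = g \<otimes> x \<otimes> (inv g \<otimes> g) \<otimes> y \<otimes> inv g"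
    using assms by (simp only: m_assoc m_closed inv_closed)
  then show ?thesis using assms by (simp add: m_assoc)
qed

lemma (in group) conj_inv:
  assumes "g \<in> carrier G" "x \<in> carrier G"
  shows "g \<otimes> inv x \<otimes> inv g = inv (g \<otimes> x \<otimes> inv g)"
  using assms by (simp add: inv_mult_group m_assoc)

lemma (in group) normal_core_normal:
  assumes H: "subgroup H G" shows "normal_core H \<lhd> G"
proof (rule normal_invI)
  show "subgroup (normal_core H) G"
  proof (rule subgroupI)
    have "g \<otimes> \<one> \<otimes> inv g \<in> H" if "g \<in> carrier G" for g
      using that subgroup.one_closed[OF H] by simp
    then have "\<one> \<in> normal_core H" by (simp add: normal_core_def)
    then show "normal_core H \<noteq> {}" by blast
  next
    fix x assume x: "x \<in> normal_core H"
    then show "inv x \<in> normal_core H"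
      using subgroup.m_inv_closed[OF H] by (auto simp: normal_core_def conj_inv)
  next
    fix x y assume "x \<in> normal_core H" "y \<in> normal_core H"
    then show "x \<otimes> y \<in> normal_core H"
      using subgroup.m_closed[OF H] by (auto simp: normal_core_def conj_mult)
  qed (auto simp: normal_core_def)
next
  fix x h assume x: "x \<in> carrier G" and h: "h \<in> normal_core H"
  have hG: "h \<in> carrier G" using h by (simp add: normal_core_def)
  have "g \<otimes> (x \<otimes> h \<otimes> inv x) \<otimes> inv g \<in> H" if g: "g \<in> carrier G" for g
  proof -
    have "(g \<otimes> x) \<otimes> h \<otimes> inv (g \<otimes> x) \<in> H" using h g x by (simp add: normal_core_def)
    then show ?thesis using g x hG by (simp add: inv_mult_group m_assoc)
  qed
  then show "x \<otimes> h \<otimes> inv x \<in> normal_core H" using x hG by (simp add: normal_core_def)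
qed

section \<open>Topological groups: translations, open subgroups and closures\<close>

context topological_group
begin

lemma continuous_map_mult:
  assumes "continuous_map X T f" "continuous_map X T g"
  shows "continuous_map X T (\<lambda>x. f x \<otimes> g x)"
  using continuous_map_compose[OF continuous_map_pairedI[OF assms] continuous_mult]
  by (simp add: o_def)

lemma continuous_map_const_carrier: "g \<in> carrier G \<Longrightarrow> continuous_map X T (\<lambda>x. g)"
  by (simp add: topspace_eq_carrier)

lemma homeomorphic_map_rmult:
  assumes g: "g \<in> carrier G" shows "homeomorphic_map T T (\<lambda>x. x \<otimes> g)"
proof -
  have "homeomorphic_maps T T (\<lambda>x. x \<otimes> g) (\<lambda>x. x \<otimes> inv g)"
    unfolding homeomorphic_maps_def using g
    by (auto simp: topspace_eq_carrier m_assoc intro!: continuous_map_mult continuous_map_const_carrier continuous_map_id[unfolded id_def])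
  then show ?thesis using homeomorphic_maps_map by blast
qed

lemma homeomorphic_map_lmult:
  assumes g: "g \<in> carrier G" shows "homeomorphic_map T T (\<lambda>x. g \<otimes> x)"
proof -
  have "homeomorphic_maps T T (\<lambda>x. g \<otimes> x) (\<lambda>x. inv g \<otimes> x)"
    unfolding homeomorphic_maps_def using g
    by (auto simp: topspace_eq_carrier m_assoc[symmetric] intro!: continuous_map_mult continuous_map_const_carrier continuous_map_id[unfolded id_def])
  then show ?thesis using homeomorphic_maps_map by blast
qed

lemma continuous_map_conj:
  assumes g: "g \<in> carrier G" shows "continuous_map T T (\<lambda>x. g \<otimes> x \<otimes> inv g)"
  using g by (intro continuous_map_mult continuous_map_const_carrier continuous_map_id[unfolded id_def]) auto

lemma openin_carrierD: "openin T U \<Longrightarrow> U \<subseteq> carrier G"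
  using openin_subset topspace_eq_carrier by blast

lemma closedin_carrierD: "closedin T U \<Longrightarrow> U \<subseteq> carrier G"
  using closedin_subset topspace_eq_carrier by blast

lemma openin_r_coset:
  assumes "openin T U" "g \<in> carrier G" shows "openin T (U #> g)"
proof -
  have "U #> g = (\<lambda>x. x \<otimes> g) ` U" by (auto simp: r_coset_def)
  then show ?thesis
    using homeomorphic_map_openness[OF homeomorphic_map_rmult[OF assms(2)] openin_subset[OF assms(1)]] assms(1) by simp
qed

lemma openin_l_coset:
  assumes "openin T U" "g \<in> carrier G" shows "openin T (g <# U)"
proof -
  have "g <# U = (\<lambda>x. g \<otimes> x) ` U" by (auto simp: l_coset_def)
  then show ?thesis
    using homeomorphic_map_openness[OF homeomorphic_map_lmult[OF assms(2)] openin_subset[OF assms(1)]] assms(1) by simp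
qed

lemma closedin_l_coset:
  assumes "closedin T U" "g \<in> carrier G" shows "closedin T (g <# U)"
proof -
  have "g <# U = (\<lambda>x. g \<otimes> x) ` U" by (auto simp: l_coset_def)
  then show ?thesis
    using homeomorphic_map_closedness[OF homeomorphic_map_lmult[OF assms(2)] closedin_subset[OF assms(1)]] assms(1) by simp
qed

lemma openin_set_mult:
  assumes "openin T U" "H \<subseteq> carrier G" shows "openin T (H <#> U)"
proof -
  have "H <#> U = (\<Union>h\<in>H. h <# U)" by (auto simp: set_mult_def l_coset_def)
  then show ?thesis using assms by (auto intro!: openin_Union openin_l_coset)
qed

lemma open_subgroup_closedin:
  assumes H: "subgroup H G" "openin T H" shows "closedin T H"
proof -
  have "openin T (\<Union>g\<in>carrier G - H. H #> g)"
    using H(2) by (auto intro!: openin_Union openin_r_coset)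
  moreover have "(\<Union>g\<in>carrier G - H. H #> g) = carrier G - H"
  proof
    show "(\<Union>g\<in>carrier G - H. H #> g) \<subseteq> carrier G - H"
    proof
      fix x assume "x \<in> (\<Union>g\<in>carrier G - H. H #> g)"
      then obtain g h where gh: "g \<in> carrier G" "g \<notin> H" "h \<in> H" "x = h \<otimes> g"
        by (auto simp: r_coset_def)
      have hG: "h \<in> carrier G" using subgroup.mem_carrier[OF H(1) gh(3)] .
      have "x \<notin> H"
      proof
        assume "x \<in> H"
        then have "inv h \<otimes> x \<in> H"
          using subgroup.m_closed[OF H(1) subgroup.m_inv_closed[OF H(1) gh(3)]] by simp
        then show False using gh hG by (simp add: m_assoc[symmetric])
      qed
      then show "x \<in> carrier G - H" using gh hG by simp
    qed
    show "carrier G - H \<subseteq> (\<Union>g\<in>carrier G - H. H #> g)"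
      using rcos_self[OF _ H(1)] by blast
  qed
  ultimately show ?thesis
    using subgroup.subset[OF H(1)] by (simp add: closedin_def topspace_eq_carrier)
qed

lemma open_normal_subgroupsD:
  assumes "N \<in> open_normal_subgroups G T"
  shows "N \<lhd> G" "openin T N" "subgroup N G" "closedin T N" "N \<subseteq> carrier G" "\<one> \<in> N"
proof -
  show N: "N \<lhd> G" "openin T N" using assms by (auto simp: open_normal_subgroups_def)
  show sub: "subgroup N G" by (rule normal_imp_subgroup[OF N(1)])
  show "closedin T N" by (rule open_subgroup_closedin[OF sub N(2)])
  show "N \<subseteq> carrier G" "\<one> \<in> N" using subgroup.subset[OF sub] subgroup.one_closed[OF sub] by auto
qed

text \<open>The closure of \<open>H \<times> H\<close> is the product of the closures, so continuity
  of multiplication and inversion carries the subgroup laws over.\<close>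

lemma closure_of_subgroup:
  assumes H: "subgroup H G" shows "subgroup (T closure_of H) G"
proof (rule subgroupI)
  have sub: "H \<subseteq> T closure_of H"
    using closure_of_subset[of H T] subgroup.subset[OF H] topspace_eq_carrier by simp
  show "T closure_of H \<subseteq> carrier G"
    using closure_of_subset_topspace topspace_eq_carrier by metis
  show "T closure_of H \<noteq> {}" using sub subgroup.one_closed[OF H] by blast
  fix x assume x: "x \<in> T closure_of H"
  have "(\<lambda>x. inv x) ` (T closure_of H) \<subseteq> T closure_of ((\<lambda>x. inv x) ` H)"
    by (rule continuous_map_image_closure_subset[OF continuous_inv])
  moreover have "(\<lambda>x. inv x) ` H \<subseteq> H" using subgroup.m_inv_closed[OF H] by blast
  ultimately show "inv x \<in> T closure_of H" using closure_of_mono x by blast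
  fix y assume y: "y \<in> T closure_of H"
  have "(\<lambda>(x, y). x \<otimes> y) ` (prod_topology T T closure_of (H \<times> H)) \<subseteq> T closure_of ((\<lambda>(x, y). x \<otimes> y) ` (H \<times> H))"
    by (rule continuous_map_image_closure_subset[OF continuous_mult])
  moreover have "(\<lambda>(x, y). x \<otimes> y) ` (H \<times> H) \<subseteq> H" using subgroup.m_closed[OF H] by auto
  ultimately have "(\<lambda>(x, y). x \<otimes> y) ` ((T closure_of H) \<times> (T closure_of H)) \<subseteq> T closure_of H"
    unfolding closure_of_Times using closure_of_mono by blast
  then show "x \<otimes> y \<in> T closure_of H" using x y by auto
qed

lemma closure_of_normal:
  assumes N: "N \<lhd> G" shows "T closure_of N \<lhd> G"
proof (rule normal_invI)
  show "subgroup (T closure_of N) G"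
    by (rule closure_of_subgroup[OF normal_imp_subgroup[OF N]])
  fix g x assume g: "g \<in> carrier G" and x: "x \<in> T closure_of N"
  have "(\<lambda>x. g \<otimes> x \<otimes> inv g) ` (T closure_of N) \<subseteq> T closure_of ((\<lambda>x. g \<otimes> x \<otimes> inv g) ` N)"
    by (rule continuous_map_image_closure_subset[OF continuous_map_conj[OF g]])
  moreover have "(\<lambda>x. g \<otimes> x \<otimes> inv g) ` N \<subseteq> N"
    using normal.inv_op_closed2[OF N g] by blast
  ultimately show "g \<otimes> x \<otimes> inv g \<in> T closure_of N" using closure_of_mono x by blast
qed

lemma set_mult_normal_subgroup:
  assumes "subgroup H G" "N \<lhd> G" shows "subgroup (H <#> N) G"
  using mult_norm_subgroup[OF assms(2,1)] commut_normal[OF assms] by simp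

lemma subset_set_mult:
  assumes "H \<subseteq> carrier G" "\<one> \<in> N" shows "H \<subseteq> H <#> N"
  using assms by (force simp: set_mult_def)

lemma subset_set_mult_right:
  assumes "N \<subseteq> carrier G" "\<one> \<in> H" shows "N \<subseteq> H <#> N"
  using assms by (force simp: set_mult_def)

lemma set_mult_subset_subgroup:
  assumes "subgroup K G" "H \<subseteq> K" "N \<subseteq> K" shows "H <#> N \<subseteq> K"
  using assms subgroup.m_closed[OF assms(1)] by (auto simp: set_mult_def)

lemma set_mult_open_normal:
  assumes H: "subgroup H G" and N: "N \<in> open_normal_subgroups G T"
  shows "subgroup (H <#> N) G" "openin T (H <#> N)" "closedin T (H <#> N)"
    "H \<subseteq> H <#> N" "N \<subseteq> H <#> N"
proof -
  note N' = open_normal_subgroupsD[OF N]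
  show sub: "subgroup (H <#> N) G" by (rule set_mult_normal_subgroup[OF H N'(1)])
  show op: "openin T (H <#> N)" by (rule openin_set_mult[OF N'(2) subgroup.subset[OF H]])
  show "closedin T (H <#> N)" by (rule open_subgroup_closedin[OF sub op])
  show "H \<subseteq> H <#> N" by (rule subset_set_mult[OF subgroup.subset[OF H] N'(6)])
  show "N \<subseteq> H <#> N" by (rule subset_set_mult_right[OF N'(5) subgroup.one_closed[OF H]])
qed

end

section \<open>Profinite groups: finite index and small open normal subgroups\<close>

context profinite_group
begin

text \<open>The cosets form an open cover of a compact space; a finite subcover is finite
  index.\<close>

lemma open_subgroup_transversal:
  assumes H: "subgroup H G" "openin T H"
  obtains R where "finite R" "R \<subseteq> carrier G" "carrier G = (\<Union>r\<in>R. H #> r)"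
proof -
  have "compactin T (carrier G)" using compact topspace_eq_carrier by (simp add: compact_space_def)
  moreover have "\<And>U. U \<in> (\<lambda>g. H #> g) ` carrier G \<Longrightarrow> openin T U"
    using H(2) by (auto intro: openin_r_coset)
  moreover have "carrier G \<subseteq> \<Union>((\<lambda>g. H #> g) ` carrier G)"
    using rcos_self[OF _ H(1)] by blast
  ultimately obtain \<F> where F: "finite \<F>" "\<F> \<subseteq> (\<lambda>g. H #> g) ` carrier G" "carrier G \<subseteq> \<Union>\<F>"
    using compactinD by metis
  obtain R where R: "R \<subseteq> carrier G" "finite R" "\<F> = (\<lambda>g. H #> g) ` R"
    using finite_subset_image[OF F(1,2)] by blast
  have "(\<Union>r\<in>R. H #> r) \<subseteq> carrier G"
    using R(1) r_coset_subset_G[OF subgroup.subset[OF H(1)]] by blast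
  then show thesis using that[OF R(2,1)] F(3) R(3) by blast
qed

lemma finite_open_subgroup_imp_finite:
  assumes "subgroup H G" "openin T H" "finite H" shows "finite (carrier G)"
proof -
  obtain R where "finite R" "carrier G = (\<Union>r\<in>R. H #> r)"
    by (rule open_subgroup_transversal[OF assms(1,2)])
  then show ?thesis using assms(3) by (simp add: r_coset_def)
qed

lemma finite_rcosets_open:
  assumes H: "subgroup H G" "openin T H" shows "finite (rcosets H)"
proof -
  obtain R where R: "finite R" "R \<subseteq> carrier G" "carrier G = (\<Union>r\<in>R. H #> r)"
    by (rule open_subgroup_transversal[OF H])
  have "rcosets H \<subseteq> (\<lambda>r. H #> r) ` R"
  proof
    fix C assume "C \<in> rcosets H"
    then obtain g where g: "g \<in> carrier G" "C = H #> g" by (auto simp: RCOSETS_def)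
    then obtain r where "r \<in> R" "g \<in> H #> r" using R(3) by blast
    then show "C \<in> (\<lambda>r. H #> r) ` R"
      using repr_independence[OF _ _ H(1)] R(2) g(2) by blast
  qed
  then show ?thesis using R(1) finite_surj by blast
qed

text \<open>The conjugation condition for \<open>h \<otimes> r\<close> with \<open>h\<close> in
  \<open>H\<close> is equivalent to the one for \<open>r\<close>, so one condition for each of
  finitely many coset representatives is enough.\<close>

lemma normal_core_open:
  assumes H: "subgroup H G" "openin T H" shows "openin T (normal_core H)"
proof -
  obtain R where R: "finite R" "R \<subseteq> carrier G" "carrier G = (\<Union>r\<in>R. H #> r)"
    by (rule open_subgroup_transversal[OF H])
  let ?V = "\<lambda>r. {x \<in> topspace T. r \<otimes> x \<otimes> inv r \<in> H}"
  have op: "openin T (?V r)" if "r \<in> R" for r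
    using openin_continuous_map_preimage[OF continuous_map_conj H(2)] that R(2) by blast
  have "normal_core H = carrier G \<inter> (\<Inter>r\<in>R. ?V r)"
  proof
    show "normal_core H \<subseteq> carrier G \<inter> (\<Inter>r\<in>R. ?V r)"
      using R(2) by (auto simp: normal_core_def topspace_eq_carrier)
    show "carrier G \<inter> (\<Inter>r\<in>R. ?V r) \<subseteq> normal_core H"
    proof
      fix x assume x: "x \<in> carrier G \<inter> (\<Inter>r\<in>R. ?V r)"
      have "g \<otimes> x \<otimes> inv g \<in> H" if g: "g \<in> carrier G" for g
      proof -
        obtain r where "r \<in> R" "g \<in> H #> r" using g R(3) by blast
        then obtain h where h: "h \<in> H" "g = h \<otimes> r" by (auto simp: r_coset_def)
        have G: "h \<in> carrier G" "r \<in> carrier G" "x \<in> carrier G"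
          using subgroup.mem_carrier[OF H(1) h(1)] \<open>r \<in> R\<close> R(2) x by auto
        have "h \<otimes> (r \<otimes> x \<otimes> inv r) \<otimes> inv h \<in> H"
          using x \<open>r \<in> R\<close> h(1) subgroup.m_closed[OF H(1)] subgroup.m_inv_closed[OF H(1)] by simp
        then show ?thesis using G h(2) by (simp add: inv_mult_group m_assoc)
      qed
      then show "x \<in> normal_core H" using x by (simp add: normal_core_def)
    qed
  qed
  \<comment> \<open>For empty \<open>R\<close> the inner intersection is \<open>UNIV\<close>, and
    the factor \<open>carrier G\<close> is what keeps the set open.\<close>
  moreover have "openin T (carrier G \<inter> (\<Inter>r\<in>R. ?V r))"
    using R(1) op openin_topspace[of T] topspace_eq_carrier
    by (cases "R = {}") (auto intro!: openin_Int openin_Inter)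
  ultimately show ?thesis by simp
qed

lemma normal_core_open_normal:
  assumes "subgroup H G" "openin T H"
  shows "normal_core H \<in> open_normal_subgroups G T"
  using normal_core_normal[OF assms(1)] normal_core_open[OF assms]
  by (simp add: open_normal_subgroups_def)

text \<open>Van Dantzig's argument: the elements stabilising a clopen neighbourhood of \<open>\<one>\<close>
  under right multiplication form an open subgroup inside it.\<close>

lemma open_subgroup_in_clopen:
  assumes C: "openin T C" "closedin T C" "\<one> \<in> C"
  obtains H where "subgroup H G" "openin T H" "H \<subseteq> C"
proof -
  have CG: "C \<subseteq> carrier G" by (rule openin_carrierD[OF C(1)])
  let ?V = "{g \<in> carrier G. \<forall>c\<in>C. c \<otimes> g \<in> C}"
  let ?H = "{g \<in> ?V. inv g \<in> ?V}"
  \<comment> \<open>The complement of \<open>?V\<close> is the projection of the closed set of pairs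
    \<open>(c, g)\<close> with \<open>c \<in> C\<close> and \<open>c \<otimes> g \<notin> C\<close>;
    projecting along a compact factor preserves closedness.\<close>
  have "openin T ?V"
  proof -
    have "closedin (prod_topology T T) {z \<in> topspace (prod_topology T T). (\<lambda>(x, y). x \<otimes> y) z \<in> carrier G - C}"
      using C(1) topspace_eq_carrier
      by (intro closedin_continuous_map_preimage[OF continuous_mult]) (metis closedin_diff closedin_topspace)
    then have "closedin (prod_topology T T)
        ((C \<times> carrier G) \<inter> {z \<in> topspace (prod_topology T T). (\<lambda>(x, y). x \<otimes> y) z \<in> carrier G - C})"
      using C(2) topspace_eq_carrier closedin_topspace[of T]
      by (intro closedin_Int) (simp_all add: closedin_prod_Times_iff)
    then have "closedin T (snd ` ((C \<times> carrier G) \<inter> {z \<in> topspace (prod_topology T T). (\<lambda>(x, y). x \<otimes> y) z \<in> carrier G - C}))"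
      using closed_map_snd[OF compact, of T] by (simp add: closed_map_def)
    moreover have "snd ` ((C \<times> carrier G) \<inter> {z \<in> topspace (prod_topology T T). (\<lambda>(x, y). x \<otimes> y) z \<in> carrier G - C})
        = carrier G - ?V"
      using CG by (force simp: topspace_eq_carrier image_iff)
    ultimately have "closedin T (carrier G - ?V)" by simp
    then have "openin T (carrier G - (carrier G - ?V))"
      using openin_diff[OF openin_topspace[of T]] topspace_eq_carrier by simp
    moreover have "carrier G - (carrier G - ?V) = ?V" by blast
    ultimately show ?thesis by simp
  qed
  then have "openin T (?V \<inter> {x \<in> topspace T. inv x \<in> ?V})"
    by (intro openin_Int openin_continuous_map_preimage[OF continuous_inv])
  moreover have "?V \<inter> {x \<in> topspace T. inv x \<in> ?V} = ?H" by (auto simp: topspace_eq_carrier)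
  ultimately have op: "openin T ?H" by simp
  have V_mult: "x \<otimes> y \<in> ?V" if "x \<in> ?V" "y \<in> ?V" for x y
  proof -
    have "c \<otimes> (x \<otimes> y) \<in> C" if c: "c \<in> C" for c
    proof -
      have "(c \<otimes> x) \<otimes> y \<in> C" using c \<open>x \<in> ?V\<close> \<open>y \<in> ?V\<close> by blast
      then show ?thesis using c CG \<open>x \<in> ?V\<close> \<open>y \<in> ?V\<close> by (simp add: m_assoc subset_iff)
    qed
    then show ?thesis using that by simp
  qed
  have "subgroup ?H G"
  proof (rule subgroupI)
    have "c \<otimes> \<one> \<in> C" if "c \<in> C" for c using that CG by (simp add: subset_iff)
    then have "\<one> \<in> ?H" by simp
    then show "?H \<noteq> {}" by blast
  next
    fix x assume "x \<in> ?H" then show "inv x \<in> ?H" by simp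
  next
    fix x y assume x: "x \<in> ?H" and y: "y \<in> ?H"
    have "x \<otimes> y \<in> ?V" using V_mult x y by blast
    moreover have "inv y \<otimes> inv x \<in> ?V" using V_mult[of "inv y" "inv x"] x y by blast
    moreover have "inv (x \<otimes> y) = inv y \<otimes> inv x" using x y by (simp add: inv_mult_group)
    ultimately show "x \<otimes> y \<in> ?H" by simp
  qed auto
  moreover have "?H \<subseteq> C"
  proof
    fix x assume "x \<in> ?H"
    then have "\<one> \<otimes> x \<in> C" "x \<in> carrier G" using C(3) by blast+
    then show "x \<in> C" by simp
  qed
  ultimately show thesis using op that by blast
qed

text \<open>Connected sets have at most one point, so the cut wire fence theorem gives a clopen set
  between \<open>\<one>\<close> and \<open>W\<close>. It contains an open subgroup, whose normal
  core is still open.\<close>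

lemma open_normal_subgroup_in_nhd:
  assumes W: "openin T W" "\<one> \<in> W"
  obtains N where "N \<in> open_normal_subgroups G T" "N \<subseteq> W"
proof -
  have "separated_between T {\<one>} (topspace T - W)"
  proof (rule cut_wire_fence_theorem[OF compact Hausdorff])
    show "closedin T {\<one>}" using closedin_Hausdorff_singleton[OF Hausdorff] topspace_eq_carrier by simp
    show "closedin T (topspace T - W)" using W(1) by blast
    fix C assume "connectedin T C"
    then obtain x where "C \<subseteq> {x}" using totally_disconnected by blast
    then show "disjnt C {\<one>} \<or> disjnt C (topspace T - W)" using W(2) by (auto simp: disjnt_def)
  qed
  then obtain U V where UV: "openin T U" "openin T V" "U \<union> V = topspace T" "disjnt U V" "\<one> \<in> U" "topspace T - W \<subseteq> V"
    unfolding separated_between_def by blast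
  have "U = topspace T - V" using UV(3,4) openin_subset[OF UV(1)] by (auto simp: disjnt_def)
  then have "closedin T U" using UV(2) by blast
  then obtain H where H: "subgroup H G" "openin T H" "H \<subseteq> U"
    using open_subgroup_in_clopen[OF UV(1) _ UV(5)] by metis
  have "U \<subseteq> W" using \<open>U = topspace T - V\<close> UV(6) by blast
  then show thesis
    using that[OF normal_core_open_normal[OF H(1,2)]] normal_core_subset[OF subgroup.subset[OF H(1)]] H(3) by blast
qed

text \<open>In other words, a closed set \<open>L\<close> is the intersection of the products
  \<open>L <#> U\<close>. The group \<open>U\<close> is chosen inside the open set of all
  \<open>y\<close> with \<open>x \<otimes> inv y\<close> outside \<open>L\<close>.\<close>

lemma closed_subset_separated:
  assumes L: "closedin T L" and x: "x \<in> carrier G" "x \<notin> L"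
  obtains U where "U \<in> open_normal_subgroups G T" "x \<notin> L <#> U"
proof -
  let ?W = "{y \<in> topspace T. x \<otimes> inv y \<in> carrier G - L}"
  have "openin T (carrier G - L)" using L topspace_eq_carrier by (metis openin_diff openin_topspace)
  moreover have "continuous_map T T (\<lambda>y. x \<otimes> inv y)"
    using x(1) continuous_inv by (intro continuous_map_mult continuous_map_const_carrier)
  ultimately have "openin T ?W" by (rule openin_continuous_map_preimage[rotated])
  moreover have "\<one> \<in> ?W" using x topspace_eq_carrier by simp
  ultimately obtain U where U: "U \<in> open_normal_subgroups G T" "U \<subseteq> ?W"
    by (rule open_normal_subgroup_in_nhd)
  have "x \<notin> L <#> U"
  proof
    assume "x \<in> L <#> U"
    then obtain l u where lu: "l \<in> L" "u \<in> U" "x = l \<otimes> u" by (auto simp: set_mult_def)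
    have "l \<in> carrier G" "u \<in> carrier G"
      using lu closedin_carrierD[OF L] open_normal_subgroupsD(5)[OF U(1)] by auto
    then have "x \<otimes> inv u = l" using lu(3) by (simp add: m_assoc)
    moreover have "x \<otimes> inv u \<notin> L" using U(2) lu(2) by blast
    ultimately show False using lu(1) by simp
  qed
  with U(1) show thesis by (rule that)
qed

end

section \<open>Insoluble just-infinite pro-\<open>p\<close> groups\<close>

text \<open>The series strictly decreases: if \<open>H\<close> equalled its derived subgroup, then
  \<open>{\<one>}\<close> would be a supplement to the latter in \<open>H\<close>, hence equal to
  \<open>H\<close>.\<close>

lemma (in group) p_group_trivial_derived_series:
  assumes p: "prime p" and ord: "order G = p ^ k" and H: "subgroup H G"
  shows "\<exists>n. (derived G ^^ n) H = {\<one>}"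
  using H
proof (induction "card H" arbitrary: H rule: less_induct)
  case less
  show ?case
  proof (cases "H = {\<one>}")
    case True
    then have "(derived G ^^ 0) H = {\<one>}" by simp
    then show ?thesis by (rule exI)
  next
    case False
    have fin: "finite (carrier G)" using ord p order_gt_0_iff_finite prime_gt_0_nat by fastforce
    have HG: "H \<subseteq> carrier G" by (rule subgroup.subset[OF less.prems])
    have sub: "subgroup (derived G H) G" by (rule derived_is_subgroup[OF HG])
    have "derived G H \<subseteq> H" by (rule derived_incl[OF subset_refl less.prems])
    moreover have "derived G H \<noteq> H"
    proof
      assume eq: "derived G H = H"
      have "{\<one>} <#> derived G H = H" using HG unfolding eq by (force simp: set_mult_def)
      moreover have "{\<one>} \<subseteq> H" using subgroup.one_closed[OF less.prems] by simp
      ultimately have "{\<one>} = H"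
        by (intro p_group_supplement_derived_subgroup[OF p ord less.prems normal_imp_subgroup[OF one_is_normal]])
      then show False using False by simp
    qed
    ultimately have "card (derived G H) < card H"
      using finite_subset[OF HG fin] by (intro psubset_card_mono) auto
    then obtain n where "(derived G ^^ n) (derived G H) = {\<one>}" using less.hyps[OF _ sub] by blast
    then have "(derived G ^^ Suc n) H = {\<one>}" by (simp only: funpow_Suc_right o_apply)
    then show ?thesis by (rule exI)
  qed
qed

section \<open>Closures of derived subgroups and their images in finite quotients\<close>

context topological_group
begin

text \<open>The product \<open>D <#> U\<close> is a closed set containing \<open>D\<close>, so
  passing to the closure adds no new coset of \<open>U\<close>.\<close>

lemma image_closure_of_rcoset:
  assumes D: "subgroup D G" and U: "U \<in> open_normal_subgroups G T"
  shows "(\<lambda>x. U #> x) ` (T closure_of D) = (\<lambda>x. U #> x) ` D"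
proof
  note U' = open_normal_subgroupsD[OF U]
  have "T closure_of D \<subseteq> D <#> U"
    by (rule closure_of_minimal[OF set_mult_open_normal(4,3)[OF D U]])
  then have sub: "T closure_of D \<subseteq> U <#> D" using commut_normal[OF D U'(1)] by simp
  show "(\<lambda>x. U #> x) ` (T closure_of D) \<subseteq> (\<lambda>x. U #> x) ` D"
  proof (rule image_subsetI)
    fix x assume "x \<in> T closure_of D"
    then obtain u d where ud: "u \<in> U" "d \<in> D" "x = u \<otimes> d" using sub by (auto simp: set_mult_def)
    then have "x \<in> U #> d" by (auto simp: r_coset_def)
    then have "U #> d = U #> x"
      by (rule repr_independence[OF _ subgroup.mem_carrier[OF D ud(2)] U'(3)])
    then show "U #> x \<in> (\<lambda>x. U #> x) ` D" using ud(2) by blast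
  qed
  show "(\<lambda>x. U #> x) ` D \<subseteq> (\<lambda>x. U #> x) ` (T closure_of D)"
    using closure_of_subset[of D T] subgroup.subset[OF D] topspace_eq_carrier by (intro image_mono) simp
qed

lemma rcoset_image_eqD:
  assumes L: "subgroup L G" and U: "U \<in> open_normal_subgroups G T"
    and x: "x \<in> carrier G" "U #> x \<in> (\<lambda>x. U #> x) ` L"
  shows "x \<in> L <#> U"
proof -
  note U' = open_normal_subgroupsD[OF U]
  obtain l where l: "l \<in> L" "U #> x = U #> l" using x(2) by blast
  have "x \<in> U #> l" using rcos_self[OF x(1) U'(3)] l(2) by simp
  then have "x \<in> U <#> L" using l(1) by (auto simp: r_coset_def set_mult_def)
  then show ?thesis using commut_normal[OF L U'(1)] by simp
qed

text \<open>Taking closures keeps every term closed, so that just-infiniteness can turn nontrivial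
  terms into open ones.\<close>

primrec closed_derived_series :: "nat \<Rightarrow> 'a set" where
  "closed_derived_series 0 = carrier G"
| "closed_derived_series (Suc n) = T closure_of (derived G (closed_derived_series n))"

lemma closure_of_derived_normal:
  "N \<lhd> G \<Longrightarrow> T closure_of (derived G N) \<lhd> G"
  by (rule closure_of_normal[OF derived_is_normal])

lemma closure_of_derived_subset:
  assumes "subgroup N G" "closedin T N" shows "T closure_of (derived G N) \<subseteq> N"
  by (rule closure_of_minimal[OF derived_incl[OF subset_refl assms(1)] assms(2)])

lemma closed_derived_series_image:
  assumes N: "\<And>n. closed_derived_series n \<subseteq> carrier G" and U: "U \<in> open_normal_subgroups G T"
  shows "(\<lambda>x. U #> x) ` closed_derived_series n = (derived (G Mod U) ^^ n) (carrier (G Mod U))"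
proof (induction n)
  case 0
  show ?case by (simp add: carrier_FactGroup)
next
  case (Suc n)
  interpret h: group_hom G "G Mod U" "\<lambda>x. U #> x"
    by (rule normal.group_hom_rcoset[OF open_normal_subgroupsD(1)[OF U]])
  have "(\<lambda>x. U #> x) ` closed_derived_series (Suc n) = (\<lambda>x. U #> x) ` derived G (closed_derived_series n)"
    using image_closure_of_rcoset[OF derived_is_subgroup[OF N] U] by simp
  also have "\<dots> = derived (G Mod U) ((\<lambda>x. U #> x) ` closed_derived_series n)"
    by (rule h.derived_img[OF N, symmetric])
  finally show ?case using Suc by simp
qed

end

locale insoluble_just_infinite_pro_p = pro_p_group +
  assumes prime: "prime p" and just_infinite: "just_infinite G T" and insoluble: "\<not> solvable G"
begin

lemma infinite_carrier: "infinite (carrier G)"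
  using just_infinite by (simp add: just_infinite_def)

lemma closed_normal_openin:
  "N \<lhd> G \<Longrightarrow> closedin T N \<Longrightarrow> N \<noteq> {\<one>} \<Longrightarrow> openin T N"
  using just_infinite unfolding just_infinite_def by blast

text \<open>The closure of the derived subgroup of \<open>N\<close> lies in its Frattini subgroup.\<close>

lemma closed_supplement_derived:
  assumes N: "subgroup N G" and L: "subgroup L G" "closedin T L" "L \<subseteq> N"
    and eq: "L <#> T closure_of (derived G N) = N"
  shows "L = N"
proof (rule ccontr)
  assume "L \<noteq> N"
  then obtain x where x: "x \<in> N" "x \<notin> L" using L(3) by blast
  have NG: "N \<subseteq> carrier G" by (rule subgroup.subset[OF N])
  have xG: "x \<in> carrier G" using x(1) NG by blast
  \<comment> \<open>Separating \<open>x\<close> from \<open>L\<close> moves the problem to the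
    finite \<open>p\<close>-group \<open>G Mod U\<close>. There the closure is invisible and the
    supplement lemma gives \<open>L\<close> and \<open>N\<close> the same image, although the coset
    of \<open>x\<close> is missing from that of \<open>L\<close>.\<close>
  obtain U where U: "U \<in> open_normal_subgroups G T" "x \<notin> L <#> U"
    by (rule closed_subset_separated[OF L(2) xG x(2)])
  let ?q = "\<lambda>x. U #> x"
  interpret h: group_hom G "G Mod U" ?q
    by (rule normal.group_hom_rcoset[OF open_normal_subgroupsD(1)[OF U(1)]])
  obtain k where k: "order (G Mod U) = p ^ k" using order_quotient[OF U(1)] by blast
  have DG: "derived G N \<subseteq> carrier G" by (rule derived_in_carrier[OF NG])
  have "?q ` N = ?q ` (L <#> T closure_of (derived G N))" using eq by simp
  also have "\<dots> = ?q ` L <#>\<^bsub>G Mod U\<^esub> ?q ` (T closure_of (derived G N))"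
    using closure_of_subset_topspace[of T] topspace_eq_carrier subgroup.subset[OF L(1)]
    by (intro set_mult_hom[OF h.homh]) auto
  also have "?q ` (T closure_of (derived G N)) = derived (G Mod U) (?q ` N)"
    using image_closure_of_rcoset[OF derived_is_subgroup[OF NG] U(1)] h.derived_img[OF NG] by simp
  finally have "?q ` L = ?q ` N"
    by (rule h.H.p_group_supplement_derived_subgroup[OF prime k h.subgroup_img_is_subgroup[OF N]
          h.subgroup_img_is_subgroup[OF L(1)] image_mono[OF L(3)] sym])
  then have "U #> x \<in> ?q ` L" using x(1) by blast
  then show False using rcoset_image_eqD[OF L(1) U(1) xG] U(2) by blast
qed

lemma quotient_derived_series_trivial:
  assumes U: "U \<in> open_normal_subgroups G T"
  shows "\<exists>n. (derived (G Mod U) ^^ n) (carrier (G Mod U)) = {\<one>\<^bsub>G Mod U\<^esub>}"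
proof -
  obtain k where k: "order (G Mod U) = p ^ k" using order_quotient[OF U] by blast
  interpret Q: group "G Mod U"
    by (rule normal.factorgroup_is_group[OF open_normal_subgroupsD(1)[OF U]])
  show ?thesis by (rule Q.p_group_trivial_derived_series[OF prime k Q.subgroup_self])
qed

lemma rcoset_image_trivialD:
  assumes U: "U \<in> open_normal_subgroups G T" and A: "A \<subseteq> carrier G"
    and eq: "(\<lambda>x. U #> x) ` A = {\<one>\<^bsub>G Mod U\<^esub>}"
  shows "A \<subseteq> U"
proof
  fix x assume x: "x \<in> A"
  then have "U #> x = U" using eq by auto
  then show "x \<in> U" using rcos_self[OF _ open_normal_subgroupsD(3)[OF U], of x] x A by auto
qed

text \<open>The derived series of the finite \<open>p\<close>-group \<open>G Mod N\<close> ends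
  after some \<open>n\<close> steps, so the \<open>n\<close>th derived subgroup of \<open>G\<close>
  lies in \<open>N\<close>. If \<open>N\<close> were abelian, one more step would reach
  \<open>{\<one>}\<close>, contrary to insolubility.\<close>

lemma derived_open_normal_nontrivial:
  assumes N: "N \<in> open_normal_subgroups G T"
  shows "derived G N \<noteq> {\<one>}"
proof
  assume triv: "derived G N = {\<one>}"
  note N' = open_normal_subgroupsD[OF N]
  interpret h: group_hom G "G Mod N" "\<lambda>x. N #> x"
    by (rule normal.group_hom_rcoset[OF N'(1)])
  obtain n where n: "(derived (G Mod N) ^^ n) (carrier (G Mod N)) = {\<one>\<^bsub>G Mod N\<^esub>}"
    using quotient_derived_series_trivial[OF N] by blast
  have "(\<lambda>x. N #> x) ` ((derived G ^^ n) (carrier G)) = {\<one>\<^bsub>G Mod N\<^esub>}"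
    using h.exp_of_derived_img[OF subset_refl, of n] n carrier_FactGroup[of G N] by simp
  then have "(derived G ^^ n) (carrier G) \<subseteq> N"
    by (rule rcoset_image_trivialD[OF N exp_of_derived_in_carrier[OF subset_refl]])
  then have "(derived G ^^ Suc n) (carrier G) \<subseteq> {\<one>}"
    using mono_derived[of "(derived G ^^ n) (carrier G)" N] triv by simp
  moreover have "\<one> \<in> (derived G ^^ Suc n) (carrier G)"
    by (rule subgroup.one_closed[OF exp_of_derived_is_subgroup[OF subgroup_self]])
  ultimately have "(derived G ^^ Suc n) (carrier G) = {\<one>}" by blast
  then have "solvable G" unfolding solvable_iff_trivial_derived_seq by (rule exI)
  then show False using insoluble by blast
qed

lemma closure_of_derived_open_normal:
  assumes N: "N \<in> open_normal_subgroups G T"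
  shows "T closure_of (derived G N) \<in> open_normal_subgroups G T"
proof -
  note N' = open_normal_subgroupsD[OF N]
  have nor: "T closure_of (derived G N) \<lhd> G" by (rule closure_of_derived_normal[OF N'(1)])
  have "derived G N \<subseteq> T closure_of (derived G N)"
    using closure_of_subset[of "derived G N" T] derived_in_carrier[OF N'(5)] topspace_eq_carrier by simp
  moreover have "\<one> \<in> derived G N" by (rule subgroup.one_closed[OF derived_is_subgroup[OF N'(5)]])
  ultimately have "T closure_of (derived G N) \<noteq> {\<one>}"
    using derived_open_normal_nontrivial[OF N] by blast
  then show ?thesis
    using nor closed_normal_openin[OF nor closedin_closure_of] by (simp add: open_normal_subgroups_def)
qed

lemma closed_derived_series_open_normal: "closed_derived_series n \<in> open_normal_subgroups G T"
proof (induction n)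
  case 0
  show ?case
    using normal_self openin_topspace[of T] topspace_eq_carrier by (simp add: open_normal_subgroups_def)
qed (simp add: closure_of_derived_open_normal)

lemmas closed_derived_seriesD = open_normal_subgroupsD[OF closed_derived_series_open_normal]

lemma closed_derived_series_Suc_subset: "closed_derived_series (Suc n) \<subseteq> closed_derived_series n"
  using closure_of_derived_subset[OF closed_derived_seriesD(3,4)] by simp

text \<open>The closed series maps onto the derived series of the finite \<open>p\<close>-group
  \<open>G Mod U\<close>, which ends in the trivial group.\<close>

lemma closed_derived_series_cofinal:
  assumes U: "U \<in> open_normal_subgroups G T"
  shows "\<exists>n. closed_derived_series n \<subseteq> U"
proof -
  obtain n where "(derived (G Mod U) ^^ n) (carrier (G Mod U)) = {\<one>\<^bsub>G Mod U\<^esub>}"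
    using quotient_derived_series_trivial[OF U] by blast
  then have "(\<lambda>x. U #> x) ` closed_derived_series n = {\<one>\<^bsub>G Mod U\<^esub>}"
    using closed_derived_series_image[OF closed_derived_seriesD(5) U] by simp
  then have "closed_derived_series n \<subseteq> U"
    by (rule rcoset_image_trivialD[OF U closed_derived_seriesD(5)])
  then show ?thesis by (rule exI)
qed

end

section \<open>The space of closed subgroups\<close>

lemma (in group) inv_cancel:
  assumes "x \<in> carrier G" "y \<in> carrier G"
  shows "inv x \<otimes> (x \<otimes> y) = y" "x \<otimes> (inv x \<otimes> y) = y"
  using assms by (simp_all add: m_assoc[symmetric])

text \<open>The set is the preimage in \<open>M\<close> of the centraliser of \<open>a\<close>
  modulo \<open>H\<close>. Writing \<open>[a, z]\<close> for the commutator, closure under products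
  is \<open>[a, y z] = [a, y] (y [a, z] inv y)\<close>, and closure under inverses is
  \<open>[a, inv z] = inv z (inv [a, z]) z\<close>.\<close>

lemma (in group) commutator_mod_subgroup:
  assumes M: "subgroup M G" and H: "subgroup H G" "H \<subseteq> M"
    and norm: "\<And>m h. m \<in> M \<Longrightarrow> h \<in> H \<Longrightarrow> m \<otimes> h \<otimes> inv m \<in> H" and a: "a \<in> M"
  shows "subgroup {z \<in> M. a \<otimes> z \<otimes> inv a \<otimes> inv z \<in> H} G" (is "subgroup ?Z G")
    and "H \<subseteq> {z \<in> M. a \<otimes> z \<otimes> inv a \<otimes> inv z \<in> H}"
proof -
  have MG: "z \<in> carrier G" if "z \<in> M" for z by (rule subgroup.mem_carrier[OF M that])
  note aG = MG[OF a]
  show "H \<subseteq> ?Z"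
    using H(2) subgroup.m_closed[OF H(1) norm[OF a] subgroup.m_inv_closed[OF H(1)]] by auto
  show "subgroup ?Z G"
  proof (rule subgroupI)
    show "?Z \<subseteq> carrier G" using MG by auto
    have "\<one> \<in> ?Z" using aG subgroup.one_closed[OF M] subgroup.one_closed[OF H(1)] by simp
    then show "?Z \<noteq> {}" by blast
  next
    fix z assume z: "z \<in> ?Z"
    then have zG: "z \<in> carrier G" and zM: "inv z \<in> M" using MG subgroup.m_inv_closed[OF M] by auto
    have "inv (a \<otimes> z \<otimes> inv a \<otimes> inv z) \<in> H" using z subgroup.m_inv_closed[OF H(1)] by simp
    from norm[OF zM this] have "a \<otimes> inv z \<otimes> inv a \<otimes> inv (inv z) \<in> H"
      using aG zG by (simp add: m_assoc inv_mult_group inv_cancel)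
    then show "inv z \<in> ?Z" using zM by simp
  next
    fix y z assume yz: "y \<in> ?Z" "z \<in> ?Z"
    then have G: "y \<in> carrier G" "z \<in> carrier G" using MG by auto
    have "y \<otimes> (a \<otimes> z \<otimes> inv a \<otimes> inv z) \<otimes> inv y \<in> H" using yz by (intro norm) auto
    then have "(a \<otimes> y \<otimes> inv a \<otimes> inv y) \<otimes> (y \<otimes> (a \<otimes> z \<otimes> inv a \<otimes> inv z) \<otimes> inv y) \<in> H"
      by (rule subgroup.m_closed[OF H(1), rotated]) (use yz in simp)
    then have "a \<otimes> (y \<otimes> z) \<otimes> inv a \<otimes> inv (y \<otimes> z) \<in> H"
      using aG G by (simp add: m_assoc inv_mult_group inv_cancel)
    then show "y \<otimes> z \<in> ?Z" using yz subgroup.m_closed[OF M] by simp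
  qed
qed

context topological_group
begin

lemma closed_subgroupsD:
  assumes "H \<in> closed_subgroups G T"
  shows "subgroup H G" "closedin T H" "H \<subseteq> carrier G" "\<one> \<in> H"
  using assms subgroup.subset[of H G] subgroup.one_closed[of H G] by (auto simp: closed_subgroups_def)

lemma set_mult_subset_set_mult:
  assumes N: "subgroup N G" and K: "K \<subseteq> carrier G" and H: "H \<subseteq> K <#> N" shows "H <#> N \<subseteq> K <#> N"
proof
  fix x assume "x \<in> H <#> N"
  then obtain h n where hn: "h \<in> H" "n \<in> N" "x = h \<otimes> n" by (auto simp: set_mult_def)
  obtain k m where km: "k \<in> K" "m \<in> N" "h = k \<otimes> m" using hn(1) H by (auto simp: set_mult_def)
  have "x = k \<otimes> (m \<otimes> n)"
    using hn km K subgroup.mem_carrier[OF N] by (simp add: m_assoc subset_iff)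
  then show "x \<in> K <#> N"
    using km(1) subgroup.m_closed[OF N km(2) hn(2)] by (auto simp: set_mult_def)
qed

lemma open_supgroup_of_open_normal:
  assumes H: "subgroup H G" and N: "N \<in> open_normal_subgroups G T" "N \<subseteq> H"
  shows "openin T H" "H <#> N = H"
proof -
  show "H <#> N = H"
    using set_mult_subset_subgroup[OF H subset_refl N(2)] set_mult_open_normal(4)[OF H N(1)] by blast
  then show "openin T H" using set_mult_open_normal(2)[OF H N(1)] by simp
qed

lemma subgroup_nhd_self: "H \<in> closed_subgroups G T \<Longrightarrow> H \<in> subgroup_nhd G T H N"
  by (simp add: subgroup_nhd_def)

lemma subgroup_nhd_eq: "K \<in> subgroup_nhd G T H N \<Longrightarrow> subgroup_nhd G T K N = subgroup_nhd G T H N"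
  by (auto simp: subgroup_nhd_def)

lemma subgroup_nhd_mono:
  assumes "H \<in> closed_subgroups G T" "N \<in> open_normal_subgroups G T" "M \<in> open_normal_subgroups G T" "M \<subseteq> N"
  shows "subgroup_nhd G T H M \<subseteq> subgroup_nhd G T H N"
  using subgroup_nhd_Int_subset(2)[OF assms(1-3)] assms(4) by (simp add: Int_absorb1)

lemma openin_subgroup_nhd:
  assumes "N \<in> open_normal_subgroups G T"
  shows "openin (subgroup_space G T) (subgroup_nhd G T H N)"
  unfolding openin_subgroup_space_iff
proof (intro conjI ballI)
  show "subgroup_nhd G T H N \<subseteq> closed_subgroups G T" by (auto simp: subgroup_nhd_def)
  fix K assume "K \<in> subgroup_nhd G T H N"
  then have "subgroup_nhd G T K N \<subseteq> subgroup_nhd G T H N" using subgroup_nhd_eq by simp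
  then show "\<exists>M\<in>open_normal_subgroups G T. subgroup_nhd G T K M \<subseteq> subgroup_nhd G T H N"
    using assms by blast
qed

text \<open>For a fixed \<open>N\<close> these sets partition the space, so the complement of one is
  a union of others.\<close>

lemma clopenin_subgroup_nhd:
  assumes N: "N \<in> open_normal_subgroups G T"
  shows "clopenin (subgroup_space G T) (subgroup_nhd G T H N)"
proof -
  let ?U = "\<Union>K\<in>closed_subgroups G T - subgroup_nhd G T H N. subgroup_nhd G T K N"
  have "openin (subgroup_space G T) ?U" by (intro openin_Union) (auto intro: openin_subgroup_nhd[OF N])
  moreover have "?U = closed_subgroups G T - subgroup_nhd G T H N"
    by (auto simp: subgroup_nhd_def)
  ultimately show ?thesis
    using openin_subgroup_nhd[OF N] unfolding clopenin_def closedin_def topspace_subgroup_space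
    by (auto simp: subgroup_nhd_def)
qed

end

section \<open>Separation, compactness and a countable base for the subgroup space\<close>

context profinite_group
begin

text \<open>Each product \<open>H <#> N\<close> is a union of cosets of \<open>N\<close>, and there
  are only finitely many of these.\<close>

lemma finite_subgroup_nhds:
  assumes N: "N \<in> open_normal_subgroups G T"
  shows "finite {subgroup_nhd G T H N |H. H \<in> closed_subgroups G T}"
proof -
  note N' = open_normal_subgroupsD[OF N]
  have "H <#> N \<in> Union ` Pow (rcosets N)" if H: "H \<in> closed_subgroups G T" for H
  proof -
    have "H <#> N = N <#> H" using commut_normal[OF closed_subgroupsD(1)[OF H] N'(1)] .
    also have "\<dots> = \<Union>((\<lambda>h. N #> h) ` H)" by (auto simp: set_mult_def r_coset_def)
    finally have eq: "H <#> N = \<Union>((\<lambda>h. N #> h) ` H)" .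
    have "(\<lambda>h. N #> h) ` H \<in> Pow (rcosets N)" using closed_subgroupsD(3)[OF H] by (auto simp: RCOSETS_def)
    then show ?thesis unfolding eq by (rule imageI)
  qed
  then have "{subgroup_nhd G T H N |H. H \<in> closed_subgroups G T}
    \<subseteq> (\<lambda>A. {K \<in> closed_subgroups G T. K <#> N = A}) ` Union ` Pow (rcosets N)"
    by (auto simp: subgroup_nhd_def)
  then show ?thesis
    using finite_rcosets_open[OF N'(3,2)] by (meson finite_Pow_iff finite_imageI finite_subset)
qed

lemma Hausdorff_subgroup_space: "Hausdorff_space (subgroup_space G T)"
  unfolding Hausdorff_space_def topspace_subgroup_space
proof (intro allI impI)
  fix H K assume "H \<in> closed_subgroups G T \<and> K \<in> closed_subgroups G T \<and> H \<noteq> K"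
  then have HK: "H \<in> closed_subgroups G T" "K \<in> closed_subgroups G T" "H \<noteq> K" by auto
  have sep: "\<exists>N\<in>open_normal_subgroups G T. A <#> N \<noteq> B <#> N"
    if A: "A \<in> closed_subgroups G T" and B: "B \<in> closed_subgroups G T" and x: "x \<in> A" "x \<notin> B" for A B x
  proof -
    obtain N where N: "N \<in> open_normal_subgroups G T" "x \<notin> B <#> N"
      by (rule closed_subset_separated[OF closed_subgroupsD(2)[OF B] _ x(2)])
        (use closed_subgroupsD(3)[OF A] x(1) in auto)
    moreover have "x \<in> A <#> N" using set_mult_open_normal(4)[OF closed_subgroupsD(1)[OF A] N(1)] x(1) by blast
    ultimately show ?thesis by blast
  qed
  have "\<exists>N\<in>open_normal_subgroups G T. H <#> N \<noteq> K <#> N"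
  proof (cases "H \<subseteq> K")
    case True
    then obtain x where "x \<in> K" "x \<notin> H" using HK(3) by blast
    then show ?thesis using sep[OF HK(2,1)] by metis
  next
    case False
    then obtain x where "x \<in> H" "x \<notin> K" by blast
    then show ?thesis using sep[OF HK(1,2)] by blast
  qed
  then obtain N where N: "N \<in> open_normal_subgroups G T" "H <#> N \<noteq> K <#> N" by blast
  have "disjnt (subgroup_nhd G T H N) (subgroup_nhd G T K N)"
    using N(2) by (auto simp: disjnt_iff subgroup_nhd_def)
  then show "\<exists>U V. openin (subgroup_space G T) U \<and> openin (subgroup_space G T) V \<and> H \<in> U \<and> K \<in> V \<and> disjnt U V"
    using openin_subgroup_nhd[OF N(1)] subgroup_nhd_self[OF HK(1)] subgroup_nhd_self[OF HK(2)] by metis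
qed

text \<open>Compactness of \<open>T\<close> makes the intersection of a coherent sequence of open subgroups
  surject onto each of its members.\<close>

lemma coherent_Inter:
  assumes S: "\<And>n. S n \<in> open_normal_subgroups G T"
    and V: "\<And>n. subgroup (V n) G" "\<And>n. closedin T (V n)" "\<And>n. S n \<subseteq> V n"
    and dec: "\<And>n. V (Suc n) \<subseteq> V n" and coh: "\<And>n k. V n \<subseteq> V (n + k) <#> S n"
  shows "(\<Inter>n. V n) \<in> closed_subgroups G T" "(\<Inter>n. V n) <#> S n = V n"
proof -
  have sub: "subgroup (\<Inter>n. V n) G" by (rule subgroups_Inter) (use V(1) in auto)
  moreover have "closedin T (\<Inter>n. V n)" using V(2) by (intro closedin_Inter) auto
  ultimately show "(\<Inter>n. V n) \<in> closed_subgroups G T" by (simp add: closed_subgroups_def)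
  show "(\<Inter>n. V n) <#> S n = V n"
  proof
    show "(\<Inter>n. V n) <#> S n \<subseteq> V n"
      by (rule set_mult_subset_subgroup[OF V(1) _ V(3)]) blast
    show "V n \<subseteq> (\<Inter>n. V n) <#> S n"
    proof
      fix u assume u: "u \<in> V n"
      note S' = open_normal_subgroupsD[OF S[of n]]
      have uG: "u \<in> carrier G" by (rule subgroup.mem_carrier[OF V(1) u])
      \<comment> \<open>These are the elements of \<open>V (n + m)\<close> congruent to
        \<open>u\<close> modulo \<open>S n\<close>. Coherence makes them nonempty, and a point
        \<open>z\<close> of all of them lies in every \<open>V m\<close> and differs from
        \<open>u\<close> by a factor in \<open>S n\<close>.\<close>
      let ?Z = "\<lambda>m. (u <# S n) \<inter> V (n + m)"
      have "(\<Inter>m. ?Z m) \<noteq> {}"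
      proof (rule compact_space_imp_nest[OF compact])
        show "closedin T (?Z m)" for m by (intro closedin_Int closedin_l_coset[OF S'(4) uG] V(2))
        show "?Z m \<noteq> {}" for m
        proof -
          obtain v s where vs: "v \<in> V (n + m)" "s \<in> S n" "u = v \<otimes> s"
            using u coh[of n m] by (auto simp: set_mult_def)
          have "v = u \<otimes> inv s"
            using vs subgroup.mem_carrier[OF V(1) vs(1)] subgroup.mem_carrier[OF S'(3) vs(2)] by (simp add: m_assoc)
          then have "v \<in> u <# S n" using subgroup.m_inv_closed[OF S'(3) vs(2)] by (auto simp: l_coset_def)
          then show ?thesis using vs(1) by blast
        qed
        show "decseq ?Z" using dec by (intro decseq_SucI) auto
      qed
      then obtain z where z: "\<And>m. z \<in> ?Z m" by blast
      have "z \<in> V m" for m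
      proof -
        have "V (n + m) \<subseteq> V m" by (rule lift_Suc_antimono_le[of V, OF dec]) simp
        then show ?thesis using z[of m] by blast
      qed
      moreover obtain s where s: "s \<in> S n" "z = u \<otimes> s" using z[of 0] by (auto simp: l_coset_def)
      moreover have "u = z \<otimes> inv s"
        using s uG subgroup.mem_carrier[OF S'(3) s(1)] by (simp add: m_assoc)
      ultimately show "u \<in> (\<Inter>n. V n) <#> S n"
        using subgroup.m_inv_closed[OF S'(3) s(1)] unfolding set_mult_def by blast
    qed
  qed
qed

text \<open>Koenig's lemma: each neighbourhood of level \<open>n\<close> splits into finitely many
  of level \<open>Suc n\<close>, so if the whole space had no finite subcover, there would be a
  branch of neighbourhoods without one. By \<open>coherent_Inter\<close> the branch has a common
  point \<open>?H\<close>, and a member of the cover around \<open>?H\<close> already contains one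
  of these neighbourhoods.\<close>

lemma compact_subgroup_space:
  assumes S: "\<And>n. S n \<in> open_normal_subgroups G T" "S 0 = carrier G" "\<And>n. S (Suc n) \<subseteq> S n"
    and cofinal: "\<And>U. U \<in> open_normal_subgroups G T \<Longrightarrow> \<exists>n. S n \<subseteq> U"
  shows "compact_space (subgroup_space G T)"
  unfolding compact_space_def compactin_def topspace_subgroup_space
proof (intro conjI allI impI)
  fix \<U> assume "(\<forall>U\<in>\<U>. openin (subgroup_space G T) U) \<and> closed_subgroups G T \<subseteq> \<Union>\<U>"
  then have U: "\<And>U. U \<in> \<U> \<Longrightarrow> openin (subgroup_space G T) U" "closed_subgroups G T \<subseteq> \<Union>\<U>" by auto
  let ?B = "\<lambda>H n. subgroup_nhd G T H (S n)"
  define good where "good A \<longleftrightarrow> (\<exists>\<F>. finite \<F> \<and> \<F> \<subseteq> \<U> \<and> A \<subseteq> \<Union>\<F>)" for A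
  note S' = open_normal_subgroupsD[OF S(1)]
  have good_Union: "good (\<Union>\<A>)" if "finite \<A>" "\<And>A. A \<in> \<A> \<Longrightarrow> good A" for \<A>
    using that
  proof (induction \<A> rule: finite_induct)
    case empty
    show ?case unfolding good_def by (rule exI[of _ "{}"]) simp
  next
    case (insert A \<A>)
    obtain \<F> where F: "finite \<F>" "\<F> \<subseteq> \<U>" "A \<subseteq> \<Union>\<F>" using insert.prems[of A] by (auto simp: good_def)
    obtain \<F>' where F': "finite \<F>'" "\<F>' \<subseteq> \<U>" "\<Union>\<A> \<subseteq> \<Union>\<F>'" using insert.IH insert.prems by (auto simp: good_def)
    show ?case unfolding good_def using F F' by (intro exI[of _ "\<F> \<union> \<F>'"]) auto
  qed
  have step: "\<exists>K\<in>?B H n. \<not> good (?B K (Suc n))" if "\<not> good (?B H n)" for H n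
  proof (rule ccontr)
    assume "\<not> ?thesis"
    then have all: "\<And>K. K \<in> ?B H n \<Longrightarrow> good (?B K (Suc n))" by blast
    let ?\<A> = "(\<lambda>K. ?B K (Suc n)) ` ?B H n"
    have "?\<A> \<subseteq> {subgroup_nhd G T H (S (Suc n)) |H. H \<in> closed_subgroups G T}"
      by (auto simp: subgroup_nhd_def)
    then have "finite ?\<A>" using finite_subgroup_nhds[OF S(1)] finite_subset by blast
    then have "good (\<Union>?\<A>)" using all by (intro good_Union) auto
    moreover have "?B H n \<subseteq> \<Union>?\<A>" by (auto simp: subgroup_nhd_def)
    ultimately have "good (?B H n)" unfolding good_def by (meson subset_trans)
    then show False using that by simp
  qed
  have "good (closed_subgroups G T)"
  proof (rule ccontr)
    assume bad: "\<not> good (closed_subgroups G T)"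
    have "\<exists>h. \<forall>n. (h n \<in> closed_subgroups G T \<and> \<not> good (?B (h n) n)) \<and> h (Suc n) \<in> ?B (h n) n"
    proof (rule dependent_nat_choice)
      \<comment> \<open>Since \<open>S 0\<close> is the whole group, the neighbourhood of level
        \<open>0\<close> is the whole space, which is the root of the branch.\<close>
      have "K <#> carrier G = carrier G" if "K \<in> closed_subgroups G T" for K
        using set_mult_subset_subgroup[OF subgroup_self closed_subgroupsD(3)[OF that] subset_refl]
          subset_set_mult_right[OF subset_refl closed_subgroupsD(4)[OF that]] by blast
      moreover have c: "carrier G \<in> closed_subgroups G T"
        using subgroup_self closedin_topspace[of T] topspace_eq_carrier by (simp add: closed_subgroups_def)
      ultimately have "?B (carrier G) 0 = closed_subgroups G T"
        using S(2) by (auto simp: subgroup_nhd_def)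
      then show "\<exists>H. H \<in> closed_subgroups G T \<and> \<not> good (?B H 0)" using bad c by metis
      show "\<exists>K. (K \<in> closed_subgroups G T \<and> \<not> good (?B K (Suc n))) \<and> K \<in> ?B H n"
        if H: "H \<in> closed_subgroups G T \<and> \<not> good (?B H n)" for H n
      proof -
        obtain K where "K \<in> ?B H n" "\<not> good (?B K (Suc n))" using step H by blast
        moreover from this have "K \<in> closed_subgroups G T" by (simp add: subgroup_nhd_def)
        ultimately show ?thesis by blast
      qed
    qed
    then obtain h where h: "\<And>n. h n \<in> closed_subgroups G T" "\<And>n. \<not> good (?B (h n) n)" "\<And>n. h (Suc n) \<in> ?B (h n) n"
      by blast
    define V where "V n = h n <#> S n" for n
    have hG: "h n \<subseteq> carrier G" for n by (rule closed_subgroupsD(3)[OF h(1)])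
    have V: "subgroup (V n) G" "closedin T (V n)" "S n \<subseteq> V n" for n
      unfolding V_def using set_mult_open_normal[OF closed_subgroupsD(1)[OF h(1)] S(1)] by auto
    have step': "h (Suc n) <#> S n = V n" for n
      using h(3)[of n] by (simp add: subgroup_nhd_def V_def)
    have dec: "V (Suc n) \<subseteq> V n" for n
    proof -
      have "h (Suc n) <#> S (Suc n) \<subseteq> h (Suc n) <#> S n" by (rule mono_set_mult[OF subset_refl S(3)])
      then show ?thesis using step'[of n] by (simp add: V_def)
    qed
    \<comment> \<open>By \<open>step'\<close>, passing from \<open>V (n + k)\<close> to the next
      group loses nothing modulo \<open>S (n + k)\<close>, hence nothing modulo the larger
      \<open>S n\<close>.\<close>
    have coh: "V n \<subseteq> V (n + k) <#> S n" for n k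
    proof (induction k)
      case 0
      show ?case using subset_set_mult[OF subgroup.subset[OF V(1)] S'(6)] by simp
    next
      case (Suc k)
      have "S (n + k) \<subseteq> S n" by (rule lift_Suc_antimono_le[of S, OF S(3)]) simp
      then have "h (Suc (n + k)) <#> S (n + k) \<subseteq> h (Suc (n + k)) <#> S n"
        by (rule mono_set_mult[OF subset_refl])
      then have "V (n + k) \<subseteq> h (Suc (n + k)) <#> S n" using step'[of "n + k"] by simp
      moreover
      have "h (Suc (n + k)) \<subseteq> V (Suc (n + k))"
        unfolding V_def by (rule subset_set_mult[OF hG S'(6)])
      then have "h (Suc (n + k)) <#> S n \<subseteq> V (Suc (n + k)) <#> S n"
        by (rule mono_set_mult[OF _ subset_refl])
      ultimately have "V (n + k) \<subseteq> V (Suc (n + k)) <#> S n" by (rule subset_trans)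
      then have "V (n + k) <#> S n \<subseteq> V (Suc (n + k)) <#> S n"
        by (rule set_mult_subset_set_mult[OF S'(3) subgroup.subset[OF V(1)]])
      then show ?case using Suc by simp
    qed
    let ?H = "\<Inter>n. V n"
    note H = coherent_Inter[of S V, OF S(1) V dec coh]
    obtain W where W: "W \<in> \<U>" "?H \<in> W" using U(2) H(1) by blast
    obtain N where N: "N \<in> open_normal_subgroups G T" "subgroup_nhd G T ?H N \<subseteq> W"
      using U(1)[OF W(1)] W(2) unfolding openin_subgroup_space_iff by blast
    obtain n where n: "S n \<subseteq> N" using cofinal[OF N(1)] by blast
    have "?B ?H n = ?B (h n) n" using H(2)[of n] by (simp add: subgroup_nhd_def V_def)
    then have "?B (h n) n \<subseteq> W" using subgroup_nhd_mono[OF H(1) N(1) S(1) n] N(2) by simp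
    then have "good (?B (h n) n)" unfolding good_def using W(1) by (intro exI[of _ "{W}"]) auto
    then show False using h(2) by blast
  qed
  then show "\<exists>\<F>. finite \<F> \<and> \<F> \<subseteq> \<U> \<and> closed_subgroups G T \<subseteq> \<Union>\<F>" by (simp add: good_def)
qed simp

lemma clopen_base_subgroup_space:
  fixes S :: "nat \<Rightarrow> 'a set"
  assumes S: "\<And>n. S n \<in> open_normal_subgroups G T"
    and cofinal: "\<And>U. U \<in> open_normal_subgroups G T \<Longrightarrow> \<exists>n. S n \<subseteq> U"
  shows "\<exists>\<A>. countable \<A> \<and> clopen_base (subgroup_space G T) \<A>"
proof (intro exI conjI)
  let ?A = "\<Union>n. {subgroup_nhd G T H (S n) |H. H \<in> closed_subgroups G T}"
  show "countable ?A" by (intro countable_UN countableI_type countable_finite finite_subgroup_nhds S)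
  show "clopen_base (subgroup_space G T) ?A"
    unfolding clopen_base_def
  proof (intro conjI ballI allI impI)
    fix A assume "A \<in> ?A" then show "clopenin (subgroup_space G T) A" using clopenin_subgroup_nhd[OF S] by auto
  next
    fix U H assume *: "openin (subgroup_space G T) U \<and> H \<in> U"
    then have H: "H \<in> closed_subgroups G T" and "\<exists>N\<in>open_normal_subgroups G T. subgroup_nhd G T H N \<subseteq> U"
      by (auto simp: openin_subgroup_space_iff)
    then obtain N where N: "N \<in> open_normal_subgroups G T" "subgroup_nhd G T H N \<subseteq> U" by blast
    obtain n where n: "S n \<subseteq> N" using cofinal[OF N(1)] by blast
    have "subgroup_nhd G T H (S n) \<subseteq> U" using subgroup_nhd_mono[OF H N(1) S n] N(2) by blast
    moreover have "subgroup_nhd G T H (S n) \<in> ?A" using H by blast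
    ultimately show "\<exists>A\<in>?A. H \<in> A \<and> A \<subseteq> U" using subgroup_nhd_self[OF H] by blast
  qed
qed

text \<open>The product \<open>H <#> N\<close> is itself an open subgroup, and it lies in the
  neighbourhood of \<open>H\<close> given by \<open>N\<close>.\<close>

lemma open_subgroup_dense:
  assumes U: "openin (subgroup_space G T) U" "H \<in> U"
  obtains K where "K \<in> U" "K \<in> closed_subgroups G T" "openin T K"
proof -
  from U have H: "H \<in> closed_subgroups G T" and "\<exists>N\<in>open_normal_subgroups G T. subgroup_nhd G T H N \<subseteq> U"
    by (auto simp: openin_subgroup_space_iff)
  then obtain N where N: "N \<in> open_normal_subgroups G T" "subgroup_nhd G T H N \<subseteq> U" by blast
  note HN = set_mult_open_normal[OF closed_subgroupsD(1)[OF H] N(1)]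
  have "(H <#> N) <#> N = H <#> N" by (rule open_supgroup_of_open_normal(2)[OF HN(1) N(1) HN(5)])
  then have "H <#> N \<in> subgroup_nhd G T H N" using HN by (simp add: subgroup_nhd_def closed_subgroups_def)
  then show thesis using that[of "H <#> N"] N(2) HN by (auto simp: closed_subgroups_def)
qed

end

section \<open>Isolated and non-isolated points of the subgroup space\<close>

context insoluble_just_infinite_pro_p
begin

text \<open>Choose a term \<open>?N\<close> of the closed derived series inside \<open>H\<close>,
  and let \<open>?M\<close> be the next term. If \<open>K <#> ?M = H\<close>, then
  \<open>K \<inter> ?N\<close> supplements \<open>?M\<close> in \<open>?N\<close>, so it is all of
  \<open>?N\<close> by the Frattini property; hence \<open>K\<close> contains \<open>?M\<close> and
  equals \<open>H\<close>.\<close>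

lemma open_subgroup_isolated:
  assumes H: "H \<in> closed_subgroups G T" "openin T H"
  shows "openin (subgroup_space G T) {H}"
proof -
  note H' = closed_subgroupsD[OF H(1)]
  obtain n where "closed_derived_series n \<subseteq> normal_core H"
    using closed_derived_series_cofinal[OF normal_core_open_normal[OF H'(1) H(2)]] by blast
  then have n: "closed_derived_series n \<subseteq> H" using normal_core_subset[OF H'(3)] by blast
  let ?N = "closed_derived_series n" and ?M = "closed_derived_series (Suc n)"
  have MN: "?M \<subseteq> ?N" by (rule closed_derived_series_Suc_subset)
  have HM: "H <#> ?M = H"
    by (rule open_supgroup_of_open_normal(2)[OF H'(1) closed_derived_series_open_normal]) (use MN n in blast)
  have "K = H" if K: "K \<in> subgroup_nhd G T H ?M" for K
  proof -
    have KH: "K <#> ?M = H" and K': "K \<in> closed_subgroups G T" using K HM by (auto simp: subgroup_nhd_def)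
    note Kc = closed_subgroupsD[OF K']
    have subN: "subgroup (K \<inter> ?N) G" by (rule subgroups_Inter_pair[OF Kc(1) closed_derived_seriesD(3)])
    \<comment> \<open>Dedekind's modular law: if \<open>y = k \<otimes> m\<close> with
      \<open>m\<close> in \<open>?M\<close>, then \<open>k = y \<otimes> inv m\<close> is again in
      \<open>?N\<close>.\<close>
    have "(K \<inter> ?N) <#> ?M = ?N"
    proof
      show "(K \<inter> ?N) <#> ?M \<subseteq> ?N"
        by (rule set_mult_subset_subgroup[OF closed_derived_seriesD(3) _ MN]) blast
      show "?N \<subseteq> (K \<inter> ?N) <#> ?M"
      proof
        fix y assume y: "y \<in> ?N"
        then obtain k m where km: "k \<in> K" "m \<in> ?M" "y = k \<otimes> m" using n KH by (auto simp: set_mult_def)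
        have G: "k \<in> carrier G" "m \<in> carrier G" using km Kc(3) closed_derived_seriesD(5) by blast+
        have "inv m \<in> ?N" using subgroup.m_inv_closed[OF closed_derived_seriesD(3)] km(2) MN by blast
        then have "y \<otimes> inv m \<in> ?N" by (rule subgroup.m_closed[OF closed_derived_seriesD(3) y])
        moreover have "y \<otimes> inv m = k" using km(3) G by (simp add: m_assoc)
        ultimately show "y \<in> (K \<inter> ?N) <#> ?M" using km by (auto simp: set_mult_def)
      qed
    qed
    then have "K \<inter> ?N = ?N"
      using closed_supplement_derived[OF closed_derived_seriesD(3) subN closedin_Int[OF Kc(2) closed_derived_seriesD(4)]]
      by simp
    then have "?M \<subseteq> K" using MN by blast
    then show ?thesis
      using open_supgroup_of_open_normal(2)[OF Kc(1) closed_derived_series_open_normal] KH by blast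
  qed
  then have "subgroup_nhd G T H ?M = {H}" using subgroup_nhd_self[OF H(1)] by blast
  then show ?thesis using openin_subgroup_nhd[OF closed_derived_series_open_normal] by metis
qed

text \<open>If \<open>H\<close> were the only closed subgroup \<open>K\<close> with \<open>K N = H N\<close> that is not open, then
  \<open>N\<close> would normalise \<open>H\<close>, and for \<open>x \<in> N - H\<close> the closed subgroup generated by \<open>H\<close> and \<open>x\<close>
  would be open with commutators in \<open>H\<close>, which forces \<open>H\<close> to be open.\<close>

lemma nonopen_subgroup_accumulates:
  assumes H: "H \<in> closed_subgroups G T" "\<not> openin T H" and N: "N \<in> open_normal_subgroups G T"
  shows "\<exists>K\<in>subgroup_nhd G T H N. \<not> openin T K \<and> K \<noteq> H"
proof (rule ccontr)
  assume "\<not> ?thesis"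
  then have only: "openin T K \<or> K = H" if "K \<in> subgroup_nhd G T H N" for K using that by blast
  note H' = closed_subgroupsD[OF H(1)] and N' = open_normal_subgroupsD[OF N]
  let ?M = "H <#> N"
  note M = set_mult_open_normal[OF H'(1) N]
  have nhdI: "K \<in> subgroup_nhd G T H N"
    if K: "subgroup K G" "closedin T K" "K \<subseteq> ?M" "H \<subseteq> K <#> N" for K
    using set_mult_subset_set_mult[OF N'(3) H'(3) K(3)]
      set_mult_subset_set_mult[OF N'(3) subgroup.subset[OF K(1)] K(4)] K(1,2)
    by (simp add: subgroup_nhd_def closed_subgroups_def)
  have norm_N: "g \<otimes> h \<otimes> inv g \<in> H" if g: "g \<in> N" and h: "h \<in> H" for g h
  proof -
    have gG: "g \<in> carrier G" and gN: "inv g \<in> N"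
      using g N'(5) subgroup.m_inv_closed[OF N'(3)] by auto
    \<comment> \<open>This is the conjugate of \<open>H\<close> by \<open>g\<close>, written as a
      preimage so that closedness comes from continuity. As \<open>g\<close> lies in the normal
      subgroup \<open>N\<close>, it has the same product with \<open>N\<close> as \<open>H\<close>,
      and it is open only if \<open>H\<close> is; by \<open>only\<close> it must be \<open>H\<close>
      itself.\<close>
    let ?K = "{x \<in> topspace T. inv g \<otimes> x \<otimes> inv (inv g) \<in> H}"
    have KH: "g \<otimes> y \<otimes> inv g \<in> ?K" if "y \<in> H" for y
    proof -
      have "y \<in> carrier G" using that H'(3) by blast
      then have "inv g \<otimes> (g \<otimes> y \<otimes> inv g) \<otimes> inv (inv g) = y"
        using gG by (simp add: m_assoc inv_cancel)
      then show ?thesis using that gG \<open>y \<in> carrier G\<close> by (simp add: topspace_eq_carrier)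
    qed
    have "subgroup ?K G"
    proof (rule subgroupI)
      show "?K \<noteq> {}" using KH[OF H'(4)] by blast
      show "?K \<subseteq> carrier G" using topspace_eq_carrier by auto
    next
      fix x assume "x \<in> ?K"
      then show "inv x \<in> ?K"
        using subgroup.m_inv_closed[OF H'(1)] conj_inv[of "inv g" x] gG by (simp add: topspace_eq_carrier)
    next
      fix x y assume "x \<in> ?K" "y \<in> ?K"
      then show "x \<otimes> y \<in> ?K"
        using subgroup.m_closed[OF H'(1)] conj_mult[of "inv g" x y] gG by (simp add: topspace_eq_carrier)
    qed
    moreover have "closedin T ?K"
      by (rule closedin_continuous_map_preimage[OF continuous_map_conj H'(2)]) (use gG in simp)
    moreover have "?K \<subseteq> ?M"
    proof
      fix x assume x: "x \<in> ?K"
      let ?y = "inv g \<otimes> x \<otimes> inv (inv g)"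
      have xG: "x \<in> carrier G" using x topspace_eq_carrier by simp
      have "inv ?y \<otimes> g \<otimes> ?y \<otimes> inv g \<in> N"
        using subgroup.m_closed[OF N'(3) normal.inv_op_closed1[OF N'(1) _ g] gN] x H'(3) by blast
      \<comment> \<open>The factor completing \<open>?y\<close> to \<open>x\<close> is a conjugate
        of \<open>g\<close> times \<open>inv g\<close>, so it lies in \<open>N\<close>.\<close>
      moreover have "x = ?y \<otimes> (inv ?y \<otimes> g \<otimes> ?y \<otimes> inv g)"
        using gG xG by (simp add: m_assoc inv_cancel inv_mult_group)
      ultimately show "x \<in> ?M" using x unfolding set_mult_def by blast
    qed
    moreover have "H \<subseteq> ?K <#> N"
    proof
      fix y assume y: "y \<in> H"
      let ?x = "g \<otimes> y \<otimes> inv g"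
      have yG: "y \<in> carrier G" using y H'(3) by blast
      have "?x \<in> carrier G" using gG yG by simp
      then have "inv ?x \<otimes> inv g \<otimes> ?x \<otimes> g \<in> N"
        by (rule subgroup.m_closed[OF N'(3) normal.inv_op_closed1[OF N'(1) _ gN] g])
      moreover have "y = ?x \<otimes> (inv ?x \<otimes> inv g \<otimes> ?x \<otimes> g)"
        using gG yG by (simp add: m_assoc inv_cancel inv_mult_group)
      ultimately show "y \<in> ?K <#> N" using KH[OF y] unfolding set_mult_def by blast
    qed
    ultimately have "?K \<in> subgroup_nhd G T H N" by (rule nhdI)
    then consider "openin T ?K" | "?K = H" using only by blast
    then show ?thesis
    proof cases
      case 1
      have "openin T {y \<in> topspace T. g \<otimes> y \<otimes> inv g \<in> ?K}"
        by (rule openin_continuous_map_preimage[OF continuous_map_conj[OF gG] 1])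
      moreover have "{y \<in> topspace T. g \<otimes> y \<otimes> inv g \<in> ?K} = H"
      proof
        show "H \<subseteq> {y \<in> topspace T. g \<otimes> y \<otimes> inv g \<in> ?K}" using KH H'(3) topspace_eq_carrier by auto
        show "{y \<in> topspace T. g \<otimes> y \<otimes> inv g \<in> ?K} \<subseteq> H"
          using gG by (auto simp: topspace_eq_carrier m_assoc inv_cancel)
      qed
      ultimately show ?thesis using H(2) by simp
    next
      case 2
      then show ?thesis using KH[OF h] by simp
    qed
  qed
  have norm: "m \<otimes> h \<otimes> inv m \<in> H" if m: "m \<in> ?M" and h: "h \<in> H" for m h
  proof -
    obtain a n where an: "a \<in> H" "n \<in> N" "m = a \<otimes> n" using m by (auto simp: set_mult_def)
    have G: "a \<in> carrier G" "n \<in> carrier G" "h \<in> carrier G" using an h H'(3) N'(5) by auto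
    have "a \<otimes> (n \<otimes> h \<otimes> inv n) \<otimes> inv a \<in> H"
      using an(1) norm_N[OF an(2) h] subgroup.m_closed[OF H'(1)] subgroup.m_inv_closed[OF H'(1)] by simp
    then show ?thesis using G an(3) by (simp add: m_assoc inv_mult_group)
  qed
  have "\<not> N \<subseteq> H" using open_supgroup_of_open_normal(1)[OF H'(1) N] H(2) by blast
  then obtain x where x: "x \<in> N" "x \<notin> H" by blast
  have xM: "x \<in> ?M" using x(1) M(5) by blast
  let ?W = "generate G (insert x H)"
  let ?K = "T closure_of ?W"
  have WG: "insert x H \<subseteq> carrier G" using x(1) N'(5) H'(3) by blast
  have W: "subgroup ?W G" by (rule generate_is_subgroup[OF WG])
  have K: "subgroup ?K G" by (rule closure_of_subgroup[OF W])
  have "?W \<subseteq> ?K" using closure_of_subset[of ?W T] subgroup.subset[OF W] topspace_eq_carrier by simp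
  moreover have "insert x H \<subseteq> ?W" by (auto intro: generate.incl)
  ultimately have HK: "insert x H \<subseteq> ?K" by blast
  \<comment> \<open>Commutator conditions need checking only at \<open>H\<close> and
    \<open>x\<close>, once the elements satisfying them are known to form a closed subgroup.\<close>
  have K_least: "?K \<subseteq> Z" if "subgroup Z G" "closedin T Z" "H \<subseteq> Z" "x \<in> Z" for Z
    using that by (intro closure_of_minimal generate_subgroup_incl) auto
  have KM: "?K \<subseteq> ?M" by (rule K_least[OF M(1,3,4) xM])
  have "H \<subseteq> ?K <#> N" using HK set_mult_open_normal(4)[OF K N] by blast
  then have "?K \<in> subgroup_nhd G T H N" by (intro nhdI K closedin_closure_of KM)
  then have K_open: "openin T ?K" using only[of ?K] HK x(2) by blast
  have Z_closed: "closedin T {z \<in> ?M. a \<otimes> z \<otimes> inv a \<otimes> inv z \<in> H}" if a: "a \<in> carrier G" for a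
  proof -
    have "continuous_map T T (\<lambda>z. a \<otimes> z \<otimes> inv a \<otimes> inv z)"
      using a continuous_inv
      by (intro continuous_map_mult continuous_map_const_carrier continuous_map_id[unfolded id_def]) auto
    then have "closedin T (?M \<inter> {z \<in> topspace T. a \<otimes> z \<otimes> inv a \<otimes> inv z \<in> H})"
      by (intro closedin_Int M(3) closedin_continuous_map_preimage[OF _ H'(2)])
    moreover have "?M \<inter> {z \<in> topspace T. a \<otimes> z \<otimes> inv a \<otimes> inv z \<in> H} = {z \<in> ?M. a \<otimes> z \<otimes> inv a \<otimes> inv z \<in> H}"
      using subgroup.subset[OF M(1)] topspace_eq_carrier by auto
    ultimately show ?thesis by simp
  qed
  have K_Z: "?K \<subseteq> {z \<in> ?M. a \<otimes> z \<otimes> inv a \<otimes> inv z \<in> H}" if a: "a \<in> ?M" "a \<otimes> x \<otimes> inv a \<otimes> inv x \<in> H" for a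
    using commutator_mod_subgroup[OF M(1) H'(1) M(4) norm a(1)] a xM
      Z_closed[OF subgroup.mem_carrier[OF M(1) a(1)]]
    by (intro K_least) auto
  \<comment> \<open>\<open>K_Z\<close> is used twice. As \<open>x\<close> commutes with itself, it
    commutes modulo \<open>H\<close> with every \<open>a\<close> in \<open>?K\<close>; inverting
    that commutator gives the condition on \<open>a\<close> and \<open>x\<close> from which
    \<open>a\<close> commutes modulo \<open>H\<close> with all of \<open>?K\<close>.\<close>
  have comm: "a \<otimes> b \<otimes> inv a \<otimes> inv b \<in> H" if a: "a \<in> ?K" and b: "b \<in> ?K" for a b
  proof -
    have G: "x \<in> carrier G" "a \<in> carrier G" using subgroup.mem_carrier[OF K a] WG by auto
    have "x \<otimes> x \<otimes> inv x \<otimes> inv x \<in> H" using G H'(4) by (simp add: m_assoc inv_cancel)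
    then have "x \<otimes> a \<otimes> inv x \<otimes> inv a \<in> H" using K_Z[OF xM] a by blast
    then have "inv (x \<otimes> a \<otimes> inv x \<otimes> inv a) \<in> H" by (rule subgroup.m_inv_closed[OF H'(1)])
    then have "a \<otimes> x \<otimes> inv a \<otimes> inv x \<in> H" using G by (simp add: m_assoc inv_mult_group)
    then show ?thesis using K_Z[of a] a b KM by blast
  qed
  \<comment> \<open>Openness of the closed derived subgroup is available for open normal subgroups,
    so \<open>?K\<close> is replaced by its core, whose commutators also lie in
    \<open>H\<close>.\<close>
  let ?V = "normal_core ?K"
  have V: "?V \<in> open_normal_subgroups G T" by (rule normal_core_open_normal[OF K K_open])
  have VK: "?V \<subseteq> ?K" by (rule normal_core_subset[OF subgroup.subset[OF K]])
  have "derived G ?V \<subseteq> H"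
    unfolding derived_def using comm VK by (intro generate_subgroup_incl[OF _ H'(1)]) blast
  then have "T closure_of (derived G ?V) \<subseteq> H" by (rule closure_of_minimal[OF _ H'(2)])
  then show False
    using open_supgroup_of_open_normal(1)[OF H'(1) closure_of_derived_open_normal[OF V]] H(2) by blast
qed

lemma pelczynski_like_subgroup_space: "pelczynski_like (subgroup_space G T)"
proof -
  let ?D = "{H \<in> closed_subgroups G T. openin T H}"
  \<comment> \<open>The trivial subgroup is a non-open point: if it were open, compactness would
    make the infinite group finite.\<close>
  have "{\<one>} \<in> closed_subgroups G T - ?D"
    using closedin_Hausdorff_singleton[OF Hausdorff] topspace_eq_carrier one_is_normal normal_imp_subgroup
      finite_open_subgroup_imp_finite[of "{\<one>}"] infinite_carrier
    by (auto simp: closed_subgroups_def)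
  then have D1: "topspace (subgroup_space G T) - ?D \<noteq> {}" unfolding topspace_subgroup_space by blast
  have D2: "\<forall>H\<in>?D. openin (subgroup_space G T) {H}" using open_subgroup_isolated by blast
  have D3: "\<forall>U. openin (subgroup_space G T) U \<and> U \<noteq> {} \<longrightarrow> U \<inter> ?D \<noteq> {}"
  proof (intro allI impI)
    fix U assume "openin (subgroup_space G T) U \<and> U \<noteq> {}"
    then obtain H where U: "openin (subgroup_space G T) U" "H \<in> U" by blast
    obtain K where "K \<in> U" "K \<in> closed_subgroups G T" "openin T K" by (rule open_subgroup_dense[OF U])
    then show "U \<inter> ?D \<noteq> {}" by blast
  qed
  have D4: "\<forall>U H. openin (subgroup_space G T) U \<and> H \<in> U - ?D \<longrightarrow> (\<exists>K\<in>U - ?D. K \<noteq> H)"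
  proof (intro allI impI)
    fix U H assume *: "openin (subgroup_space G T) U \<and> H \<in> U - ?D"
    then have H: "H \<in> closed_subgroups G T" and "\<exists>N\<in>open_normal_subgroups G T. subgroup_nhd G T H N \<subseteq> U"
      by (auto simp: openin_subgroup_space_iff)
    then obtain N where N: "N \<in> open_normal_subgroups G T" "subgroup_nhd G T H N \<subseteq> U" by blast
    have "\<not> openin T H" using * H by blast
    then obtain K where "K \<in> subgroup_nhd G T H N" "\<not> openin T K" "K \<noteq> H"
      using nonopen_subgroup_accumulates[OF H _ N(1)] by blast
    then show "\<exists>K\<in>U - ?D. K \<noteq> H" using N(2) by blast
  qed
  have base: "\<exists>\<A>. countable \<A> \<and> clopen_base (subgroup_space G T) \<A>"
    by (rule clopen_base_subgroup_space[OF closed_derived_series_open_normal closed_derived_series_cofinal])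
  have "compact_space (subgroup_space G T)"
    by (rule compact_subgroup_space[OF closed_derived_series_open_normal _
          closed_derived_series_Suc_subset closed_derived_series_cofinal]) simp
  then show ?thesis
    unfolding pelczynski_like_def using Hausdorff_subgroup_space base D1 D2 D3 D4
    by (intro conjI exI[of _ ?D])
qed

end

theorem corollary4p4:
  fixes G :: "('a, 'b) monoid_scheme" and T :: "'a topology" and p :: nat
  assumes "prime p"
    and "pro_p_group G T p"
    and "just_infinite G T"
    and "\<not> solvable G"
  shows "subgroup_space G T homeomorphic_space pelczynski_space"
proof -
  interpret insoluble_just_infinite_pro_p G T p
    using assms by (intro insoluble_just_infinite_pro_p.intro insoluble_just_infinite_pro_p_axioms.intro)
  show ?thesis
    by (rule pelczynski_like_homeomorphic_space[OF pelczynski_like_subgroup_space pelczynski_like_pelczynski_space])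
qed

end
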